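(* Let $K=K^*=\mathcal{S}^n_+$ (order $n$ real symmetric positive semidefinite matrices) in $Y=\mathcal{S}^n$ (order $n$ real symmetric matrices), let $A:\mathbb{R}^m\to\mathcal{S}^n$ be an injective linear map, $b\in\mathcal{S}^n$, $c\in\mathbb{R}^m$, and consider the semidefinite systems $$(P)\quad Ax\preceq b,\qquad\qquad (D)\quad A^*y=c,\ y\succeq0.$$ Then the following hold. (1) $(D)$ is infeasible if and only if it has a reformulation $$\langle a_i',y\rangle=0\ (i=1,\dots,k),\quad \langle a_{k+1}',y\rangle=-1,\quad \langle a_i',y\rangle=c_i'\ (i=k+2,\dots,m),\quad y\succeq0,$$ where $k\ge0$ and $(a_1',\dots,a_{k+1}')\in\mathrm{REGFR}_{k+1}(\mathcal{S}^n_+)$. (2) $(D)$ is not strongly infeasible if and only if there are $\ell\ge0$ and $(y_1,\dots,y_{\ell+1})\in\mathrm{REGFR}_{\ell+1}(\mathcal{S}^n_+)$ such that $A'^*y_i=0$ $(i=1,\dots,\ell)$ and $A'^*y_{\ell+1}=c'$, where $(A',c')$ is the data of a suitable reformulation of $(D)$. (3) $(P)$ is infeasible if and only if there are $k\ge0$ and $(y_1,\dots,y_{k+1})\in\mathrm{REGFR}_{k+1}(\mathcal{S}^n_+)$ such that $$A'^*y_i=0,\ \langle b',y_i\rangle=0\ (i=1,\dots,k),\qquad A'^*y_{k+1}=0,\ \langle b',y_{k+1}\rangle=-1,$$ where $(A',b')$ is the data of a suitable reformulation of $(P)$. (4) $(P)$ is not strongly infeasible if and only if it has a reformulation $$\sum_{i=1}^m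 x_ia_i'\preceq b',$$ where $(a_1',\dots,a_\ell',b')\in\mathrm{REGFR}_{\ell+1}(\mathcal{S}^n_+)$ for some $\ell\ge0$. In all parts the facial reduction sequences can be chosen pre-strict, and $k$ and $\ell$ can be chosen at most $n-1$. (The integers $k$, $\ell$ and the reformulations in the different parts may be different.)
   Context: Notation: $\langle a,b\rangle=\mathrm{trace}(ab)$ on $\mathcal{S}^n$; $s\preceq t$ means $t-s\in\mathcal{S}^n_+$; $A^*$ is the adjoint of $A$; $S^\perp$ is the orthogonal complement of the linear span of $S$. Write $Ax=\sum_{i=1}^m x_ia_i$, so $A^*y=(\langle a_1,y\rangle,\dots,\langle a_m,y\rangle)^T$. Strong infeasibility: $(P)$ is strongly infeasible if $A^*y=0,\ \langle b,y\rangle=-1,\ y\succeq0$ has a solution; $(D)$ is strongly infeasible if $Ax\succeq0,\ \langle c,x\rangle=-1$ has a solution. Reformulation: the result of a finite sequence of the operations on the data $(A,b,c)$: (i) replace $(a_i,c_i)$ by $(A\lambda,\langle c,\lambda\rangle)$ for some $i$ and $\lambda\in\mathbb{R}^m$ with $\lambda_i\ne0$; (ii) switch $(a_i,c_i)$ with $(a_j,c_j)$, $i\neq j$; (iii) replace $b$ by $b+A\mu$, $\mu\in\mathbb{R}^m$; (iv) for some invertible $n\times n$ matrix $t$, replace every $a_i$ by $t^Ta_it$ and $b$ by $t^Tbt$. Regularized facial reduction sequences: $\mathrm{REGFR}_k(\mathcal{S}^n_+)$ is the set of $(y_1,\dots,y_k)$ with $y_i\in\mathcal{S}^n$ for which there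 are integers $p_1,\dots,p_k\ge0$ with $p_1+\dots+p_k\le n$ such that, when rows and columns are partitioned into consecutive groups of sizes $p_1+\dots+p_{i-1}$, $p_i$, $n-p_1-\dots-p_i$, $$y_i=\begin{pmatrix}\times&\times&\times\\ \times&I&0\\ \times&0&0\end{pmatrix},$$ where $\times$ denotes arbitrary blocks. Every such sequence lies in $\mathrm{FR}_k(\mathcal{S}^n_+)$, where for a closed convex cone $C$, $\mathrm{FR}_k(C)=\{(y_1,\dots,y_k): y_1\in C^*,\ y_i\in(C\cap y_1^\perp\cap\dots\cap y_{i-1}^\perp)^*,\ i=2,\dots,k\}$. An element of $\mathrm{FR}_k(C)$ is strict if for $i=1,\dots,k$, $y_i\in C_i^*\setminus C_i^\perp$ with $C_i=C\cap y_1^\perp\cap\dots\cap y_{i-1}^\perp$ ($C_1=C$); it is pre-strict if $(y_1,\dots,y_{k-1})$ is strict (vacuous if $k=1$). *)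

theory Defs
  imports "HOL-Analysis.Analysis"
begin

text \<open>
  Order \<open>n\<close> matrices are \<open>real^'n^'n\<close> with \<open>n = CARD('n)\<close>, and \<open>\<real>\<^sup>m\<close> is \<open>real^'m\<close> with \<open>m = CARD('m)\<close>.
  The index types carry a linear order, because consecutive blocks and initial segments
  \<open>a\<^sub>1, \<dots>, a\<^sub>k\<close> are needed; \<open>ix i\<close> is the index at position \<open>i\<close>, counted from \<open>0\<close>.
\<close>

definition ix :: "nat \<Rightarrow> 'i::{finite,linorder}"
  where "ix i = sorted_list_of_set UNIV ! i"

definition sym_mats :: "(real^'n^'n) set"
  where "sym_mats = {a. transpose a = a}"

definition psd_cone :: "(real^'n^'n) set"
  where "psd_cone = {a \<in> sym_mats. \<forall>v. 0 \<le> v \<bullet> (a *v v)}"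

definition psd_le :: "real^'n^'n \<Rightarrow> real^'n^'n \<Rightarrow> bool" (infix \<open>\<preceq>\<close> 50)
  where "s \<preceq> t \<longleftrightarrow> t - s \<in> psd_cone"

text \<open>
  On symmetric matrices the inner product of \<open>real^'n^'n\<close> is the trace inner product, so that
  \<open>adjoint A\<close> is \<open>y \<mapsto> (\<langle>a\<^sub>1, y\<rangle>, \<dots>, \<langle>a\<^sub>m, y\<rangle>)\<close> with \<open>a\<^sub>i\<close> the value of \<open>A\<close> at the \<open>i\<close>-th unit vector.
\<close>

lemma inner_eq_trace:
  fixes a b :: "real^'n^'n"
  assumes "a \<in> sym_mats"
  shows "a \<bullet> b = trace (a ** b)"
proof -
  have *: "a $ i $ j = a $ j $ i" for i j
  proof -
    have "transpose a $ i $ j = a $ j $ i"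
      by (simp add: transpose_def)
    then show ?thesis
      using assms by (simp add: sym_mats_def)
  qed
  have "a \<bullet> b = (\<Sum>i\<in>UNIV. \<Sum>j\<in>UNIV. a $ i $ j * b $ i $ j)"
    by (simp add: inner_vec_def)
  also have "\<dots> = (\<Sum>i\<in>UNIV. \<Sum>j\<in>UNIV. a $ j $ i * b $ i $ j)"
    by (intro sum.cong refl) (metis *)
  also have "\<dots> = (\<Sum>j\<in>UNIV. \<Sum>i\<in>UNIV. a $ j $ i * b $ i $ j)"
    by (rule sum.swap)
  also have "\<dots> = trace (a ** b)"
    by (simp add: trace_def matrix_matrix_mult_def)
  finally show ?thesis .
qed

lemma adjoint_component:
  fixes A :: "real^'m \<Rightarrow> real^'n^'n"
  assumes "linear A" and "range A \<subseteq> sym_mats"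
  shows "adjoint A y $ i = trace (A (axis i 1) ** y)"
proof -
  have "adjoint A y $ i = axis i 1 \<bullet> adjoint A y"
    by (simp add: inner_axis')
  also have "\<dots> = A (axis i 1) \<bullet> y"
    using adjoint_works[OF assms(1)] by simp
  finally show ?thesis
    using assms(2) by (simp add: inner_eq_trace range_subsetD)
qed

text \<open>Dual cones and orthogonal complements are taken in the space of symmetric matrices.\<close>

definition dual_cone :: "(real^'n^'n) set \<Rightarrow> (real^'n^'n) set"
  where "dual_cone C = {y \<in> sym_mats. \<forall>x\<in>C. 0 \<le> x \<bullet> y}"

definition perp :: "(real^'n^'n) set \<Rightarrow> (real^'n^'n) set"
  where "perp S = sym_mats \<inter> orthogonal_comp (span S)"

definition cut :: "(real^'n^'n) set \<Rightarrow> (real^'n^'n) list \<Rightarrow> (real^'n^'n) set"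
  where "cut C ys = C \<inter> (\<Inter>y\<in>set ys. perp {y})"

definition FR :: "nat \<Rightarrow> (real^'n^'n) set \<Rightarrow> (real^'n^'n) list set"
  where "FR k C = {ys. length ys = k \<and> (\<forall>i<k. ys ! i \<in> dual_cone (cut C (take i ys)))}"

definition strict_FR :: "(real^'n^'n) set \<Rightarrow> (real^'n^'n) list \<Rightarrow> bool"
  where "strict_FR C ys \<longleftrightarrow> ys \<in> FR (length ys) C \<and>
    (\<forall>i<length ys. ys ! i \<in> dual_cone (cut C (take i ys)) - perp (cut C (take i ys)))"

definition pre_strict_FR :: "(real^'n^'n) set \<Rightarrow> (real^'n^'n) list \<Rightarrow> bool"
  where "pre_strict_FR C ys \<longleftrightarrow> ys \<in> FR (length ys) C \<and> strict_FR C (butlast ys)"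

text \<open>
  With \<open>s\<close> the sum of the preceding block sizes, the condition below fixes exactly the four lower
  right blocks of the \<open>i\<close>-th matrix; by symmetry the remaining blocks are the arbitrary ones.
\<close>

definition REGFR :: "nat \<Rightarrow> (real^'n::{finite,linorder}^'n::{finite,linorder}) list set"
  where "REGFR k = {ys. length ys = k \<and> set ys \<subseteq> sym_mats \<and>
    (\<exists>p :: nat list. length p = k \<and> sum_list p \<le> CARD('n) \<and>
      (\<forall>i<k. let s = sum_list (take i p) in
        \<forall>r q. s \<le> r \<and> r < CARD('n) \<and> s \<le> q \<and> q < CARD('n) \<longrightarrow>
          ys ! i $ ix r $ ix q = (if r = q \<and> r < s + p ! i then 1 else 0)))}"

type_synonym ('m, 'n) sdp_data = "(real^'m \<Rightarrow> real^'n^'n) \<times> (real^'n^'n) \<times> (real^'m)"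

definition cols :: "(real^'m \<Rightarrow> real^'n^'n) \<Rightarrow> 'm \<Rightarrow> real^'n^'n"
  where "cols A i = A (axis i 1)"

definition of_cols :: "('m \<Rightarrow> real^'n^'n) \<Rightarrow> real^'m \<Rightarrow> real^'n^'n"
  where "of_cols a x = (\<Sum>i\<in>UNIV. x $ i *\<^sub>R a i)"

text \<open>Every operation acts on all data; \<open>(P)\<close> only sees \<open>(A, b)\<close> and \<open>(D)\<close> only sees \<open>(A, c)\<close>.\<close>

inductive reform_step :: "('m::finite, 'n::finite) sdp_data \<Rightarrow> ('m, 'n) sdp_data \<Rightarrow> bool"
  where
    replace_col: "l $ i \<noteq> 0 \<Longrightarrow>
      reform_step (A, b, c)
        (of_cols ((cols A)(i := A l)), b, (\<chi> h. if h = i then c \<bullet> l else c $ h))"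
  | switch_cols: "i \<noteq> j \<Longrightarrow>
      reform_step (A, b, c)
        (of_cols ((cols A)(i := cols A j, j := cols A i)), b,
         (\<chi> h. if h = i then c $ j else if h = j then c $ i else c $ h))"
  | shift_rhs: "reform_step (A, b, c) (A, b + A u, c)"
  | rotate: "invertible t \<Longrightarrow>
      reform_step (A, b, c)
        (of_cols (\<lambda>i. transpose t ** cols A i ** t), transpose t ** b ** t, c)"

definition reformulation :: "('m::finite, 'n::finite) sdp_data \<Rightarrow> ('m, 'n) sdp_data \<Rightarrow> bool"
  where "reformulation = reform_step\<^sup>*\<^sup>*"

text \<open>The list \<open>[a\<^sub>1, \<dots>, a\<^sub>k]\<close>, meaningful for \<open>k \<le> m\<close>.\<close>

definition first_cols :: "(real^'m::{finite,linorder} \<Rightarrow> real^'n^'n) \<Rightarrow> nat \<Rightarrow> (real^'n^'n) list"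
  where "first_cols A k = map (\<lambda>i. cols A (ix i)) [0..<k]"

definition P_feasible :: "(real^'m \<Rightarrow> real^'n^'n) \<Rightarrow> real^'n^'n \<Rightarrow> bool"
  where "P_feasible A b \<longleftrightarrow> (\<exists>x. A x \<preceq> b)"

definition D_feasible :: "(real^'m \<Rightarrow> real^'n^'n) \<Rightarrow> real^'m \<Rightarrow> bool"
  where "D_feasible A c \<longleftrightarrow> (\<exists>y. adjoint A y = c \<and> 0 \<preceq> y)"

definition P_strongly_infeasible :: "(real^'m \<Rightarrow> real^'n^'n) \<Rightarrow> real^'n^'n \<Rightarrow> bool"
  where "P_strongly_infeasible A b \<longleftrightarrow> (\<exists>y. adjoint A y = 0 \<and> b \<bullet> y = -1 \<and> 0 \<preceq> y)"

definition D_strongly_infeasible :: "(real^'m \<Rightarrow> real^'n^'n) \<Rightarrow> real^'m \<Rightarrow> bool"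
  where "D_strongly_infeasible A c \<longleftrightarrow> (\<exists>x. 0 \<preceq> A x \<and> c \<bullet> x = -1)"

text \<open>
  The four certificates of the alternative theorem, as conditions on the data of a reformulation;
  \<open>k\<close> and \<open>l\<close> count the leading homogeneous members. In the first one the remaining
  \<open>c\<^sub>i\<close>, \<open>i > k + 1\<close>, are unrestricted.
\<close>

definition D_infeasible_cert
  :: "(real^'m::{finite,linorder} \<Rightarrow> real^'n::{finite,linorder}^'n::{finite,linorder}) \<Rightarrow> real^'m::{finite,linorder} \<Rightarrow> nat \<Rightarrow> bool"
  where "D_infeasible_cert A c k \<longleftrightarrow>
    k + 1 \<le> CARD('m) \<and> (\<forall>i<k. c $ ix i = 0) \<and> c $ ix k = -1 \<and>
    first_cols A (k + 1) \<in> REGFR (k + 1)"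

definition D_not_strongly_infeasible_cert
  :: "(real^'m \<Rightarrow> real^'n::{finite,linorder}^'n::{finite,linorder}) \<Rightarrow> real^'m \<Rightarrow> nat \<Rightarrow> (real^'n::{finite,linorder}^'n::{finite,linorder}) list \<Rightarrow> bool"
  where "D_not_strongly_infeasible_cert A c l ys \<longleftrightarrow>
    ys \<in> REGFR (l + 1) \<and> (\<forall>i<l. adjoint A (ys ! i) = 0) \<and> adjoint A (ys ! l) = c"

definition P_infeasible_cert
  :: "(real^'m \<Rightarrow> real^'n::{finite,linorder}^'n::{finite,linorder}) \<Rightarrow> real^'n::{finite,linorder}^'n::{finite,linorder} \<Rightarrow> nat \<Rightarrow> (real^'n::{finite,linorder}^'n::{finite,linorder}) list \<Rightarrow> bool"
  where "P_infeasible_cert A b k ys \<longleftrightarrow>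
    ys \<in> REGFR (k + 1) \<and> (\<forall>i<k. adjoint A (ys ! i) = 0 \<and> b \<bullet> (ys ! i) = 0) \<and>
    adjoint A (ys ! k) = 0 \<and> b \<bullet> (ys ! k) = -1"

definition P_not_strongly_infeasible_cert
  :: "(real^'m::{finite,linorder} \<Rightarrow> real^'n::{finite,linorder}^'n::{finite,linorder}) \<Rightarrow> real^'n::{finite,linorder}^'n::{finite,linorder} \<Rightarrow> nat \<Rightarrow> bool"
  where "P_not_strongly_infeasible_cert A b l \<longleftrightarrow>
    l \<le> CARD('m) \<and> first_cols A l @ [b] \<in> REGFR (l + 1)"

end

theory Submission
  imports Defs
begin

text \<open>
  The four equivalences are instances of one statement about a subspace \<open>U\<close> of symmetric matrices and
  a symmetric matrix \<open>h\<close>: either some semidefinite \<open>s\<close> is orthogonal to \<open>U\<close> with \<open>s \<bullet> h < 0\<close>, or there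
  are \<open>u\<^sub>1, \<dots>, u\<^sub>l \<in> U\<close> and \<open>y \<in> h + U\<close> that form a facial reduction sequence. For \<open>(D)\<close> infeasible,
  \<open>U\<close> is the image under \<open>A\<close> of the kernel of \<open>c\<close> and \<open>h = A x\<^sub>0\<close> with \<open>c \<bullet> x\<^sub>0 = -1\<close>; for \<open>(D)\<close> not
  strongly infeasible, \<open>U\<close> is the kernel of the adjoint and \<open>h\<close> is a solution of the linear equations;
  for \<open>(P)\<close> infeasible, \<open>U\<close> is the part of that kernel orthogonal to \<open>b\<close>, and \<open>h\<close> is an element of the
  kernel with \<open>b \<bullet> h = -1\<close>; for \<open>(P)\<close> not strongly infeasible, \<open>U\<close> is the range of \<open>A\<close> and \<open>h = b\<close>. In
  each case the matrix \<open>s\<close> amounts, after scaling, to a solution of the system that the certificate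
  excludes.

  Faces of the semidefinite cone are described by subspaces \<open>T\<close> of the underlying space. If a form \<open>y\<close>
  is nonnegative on \<open>T\<close>, then the matrices of the face that are orthogonal to \<open>y\<close> form the face of the
  null space of \<open>y\<close> on \<open>T\<close> (\<open>psd_face_cut\<close>). So a facial reduction sequence is a chain of forms, the
  first nonnegative everywhere and each later one nonnegative on the common null space reached so far.
  That a chain excludes \<open>s\<close> is then immediate (\<open>fr_chain_sound\<close>).

  The chain is built by induction on the dimension of \<open>T\<close> (\<open>facial_reduction\<close>). If some \<open>u \<in> U\<close> is
  nonnegative and not zero on \<open>T\<close>, it is put first and \<open>T\<close> shrinks. Otherwise every element of \<open>U\<close> that
  is nonnegative on \<open>T\<close> vanishes there, and separating a compact set from a subspace
  (\<open>psd_translate_or_separator\<close>) yields \<open>y \<in> h + U\<close> nonnegative on \<open>T\<close>, since the separating functional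
  would be a forbidden \<open>s\<close>.

  Orthonormalizing each form on its subspace gives a basis in which all members of the chain have the
  prescribed identity and zero blocks (\<open>regularizing_congruence\<close>); this is the rotation. Members of a
  strict chain are linearly independent (\<open>strict_chain_independent\<close>), so the certificates that consist
  of elements of the range of \<open>A\<close> can be made the leading columns. Finally, sequences of operations
  amount to changes of coordinates \<open>x = M x'\<close>, \<open>y = t y' t\<^sup>T\<close> together with a shift of \<open>b\<close>
  (\<open>coordinate_change_reformulation\<close>, \<open>reformulation_coordinate_change\<close>), under which solutions are
  carried along.
\<close>

section \<open>Symmetric matrices as quadratic forms\<close>

lemma subspace_sym_mats: "subspace (sym_mats :: (real^'n^'n) set)"
  by (auto simp: subspace_def sym_mats_def transpose_def vec_eq_iff)

lemma sym_mats_add: "a \<in> sym_mats \<Longrightarrow> b \<in> sym_mats \<Longrightarrow> a + b \<in> sym_mats"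
  and sym_mats_scaleR: "a \<in> sym_mats \<Longrightarrow> r *\<^sub>R a \<in> sym_mats" for a b :: "real^'n^'n"
  by (simp_all add: subspace_sym_mats subspace_add subspace_scale)

lemma sym_form_commute:
  fixes y :: "real^'n^'n"
  assumes "y \<in> sym_mats"
  shows "v \<bullet> (y *v w) = w \<bullet> (y *v v)"
proof -
  have "v \<bullet> (y *v w) = (v v* y) \<bullet> w"
    by (simp add: dot_lmul_matrix)
  also have "v v* y = y *v v"
    using assms by (simp add: sym_mats_def flip: transpose_matrix_vector)
  finally show ?thesis
    by (simp add: inner_commute)
qed

definition null_on :: "(real^'n) set \<Rightarrow> real^'n^'n \<Rightarrow> (real^'n) set"
  where "null_on T y = {v \<in> T. v \<bullet> (y *v v) = 0}"

definition psd_form_on :: "(real^'n) set \<Rightarrow> real^'n^'n \<Rightarrow> bool"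
  where "psd_form_on T y \<longleftrightarrow> y \<in> sym_mats \<and> (\<forall>v\<in>T. 0 \<le> v \<bullet> (y *v v))"

lemma psd_form_on_sym: "psd_form_on T y \<Longrightarrow> y \<in> sym_mats"
  and psd_form_on_nonneg: "psd_form_on T y \<Longrightarrow> v \<in> T \<Longrightarrow> 0 \<le> v \<bullet> (y *v v)"
  and psd_form_on_mono: "psd_form_on T y \<Longrightarrow> S \<subseteq> T \<Longrightarrow> psd_form_on S y"
  by (auto simp: psd_form_on_def)

lemma psd_cone_eq: "psd_cone = {y. psd_form_on UNIV y}"
  by (auto simp: psd_cone_def psd_form_on_def)

text \<open>If \<open>v\<close> were isotropic with \<open>w \<bullet> y v \<noteq> 0\<close>, the form would be affine and nonconstant
  along the line \<open>w + \<real> v\<close>, hence negative somewhere.\<close>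

lemma isotropic_in_radical:
  fixes y :: "real^'n^'n"
  assumes T: "subspace T" and y: "psd_form_on T y"
    and v: "v \<in> null_on T y" and w: "w \<in> T"
  shows "w \<bullet> (y *v v) = 0"
proof (rule ccontr)
  define c where "c = w \<bullet> (y *v v)"
  define a where "a = w \<bullet> (y *v w)"
  assume "w \<bullet> (y *v v) \<noteq> 0"
  then have c: "c \<noteq> 0" by (simp add: c_def)
  define \<alpha> where "\<alpha> = - (a + 1) / (2 * c)"
  have "w + \<alpha> *\<^sub>R v \<in> T"
    using T v w by (auto simp: null_on_def subspace_def)
  then have "0 \<le> (w + \<alpha> *\<^sub>R v) \<bullet> (y *v (w + \<alpha> *\<^sub>R v))"
    using y psd_form_on_nonneg by blast
  also have "\<dots> = a + 2 * \<alpha> * c"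
    using v sym_form_commute[OF psd_form_on_sym[OF y], of v w]
    by (simp add: null_on_def a_def c_def matrix_vector_right_distrib matrix_vector_mult_scaleR
        inner_add_left inner_add_right)
  also have "\<dots> = -1"
    using c by (simp add: \<alpha>_def field_simps)
  finally show False by simp
qed

lemma subspace_null_on:
  fixes y :: "real^'n^'n"
  assumes T: "subspace T" and y: "psd_form_on T y"
  shows "subspace (null_on T y)"
  unfolding subspace_def
proof (intro conjI ballI allI)
  show "0 \<in> null_on T y"
    using T by (simp add: null_on_def subspace_0)
next
  fix v w assume vw: "v \<in> null_on T y" "w \<in> null_on T y"
  then have T': "v \<in> T" "w \<in> T" by (auto simp: null_on_def)
  have "w \<bullet> (y *v v) = 0" "v \<bullet> (y *v w) = 0"
    using isotropic_in_radical[OF T y] vw T' by auto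
  then show "v + w \<in> null_on T y"
    using vw T T' by (simp add: null_on_def subspace_add matrix_vector_right_distrib
        inner_add_left inner_add_right)
next
  fix r v assume "v \<in> null_on T y"
  then show "r *\<^sub>R v \<in> null_on T y"
    using T by (simp add: null_on_def subspace_scale matrix_vector_mult_scaleR)
qed

text \<open>Gram--Schmidt for a semidefinite form: a form that is not zero on \<open>T\<close> has a vector of value
  \<open>1\<close>, and its conjugate hyperplane in \<open>T\<close> has the same null space and one dimension less.\<close>

lemma gram_basis:
  fixes y :: "real^'n^'n"
  assumes "subspace T" and "psd_form_on T y"
  shows "\<exists>es. set es \<subseteq> T \<and>
    (\<forall>i<length es. \<forall>j<length es. es ! i \<bullet> (y *v es ! j) = (if i = j then 1 else 0)) \<and>
    span (set es \<union> null_on T y) = T \<and> length es + dim (null_on T y) = dim T"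
  using assms
proof (induction "dim T" arbitrary: T rule: less_induct)
  case less
  note T = less.prems(1) and y = less.prems(2)
  show ?case
  proof (cases "null_on T y = T")
    case True
    then show ?thesis
      using T by (intro exI[of _ "[]"]) (simp add: span_eq_iff)
  next
    case False
    then obtain u where u: "u \<in> T" "u \<bullet> (y *v u) \<noteq> 0"
      by (auto simp: null_on_def)
    then have pos: "0 < u \<bullet> (y *v u)"
      using psd_form_on_nonneg[OF y u(1)] by simp
    define v where "v = (1 / sqrt (u \<bullet> (y *v u))) *\<^sub>R u"
    have vT: "v \<in> T"
      using T u(1) by (simp add: v_def subspace_scale)
    have v1: "v \<bullet> (y *v v) = 1"
    proof -
      have "sqrt (u \<bullet> (y *v u)) * sqrt (u \<bullet> (y *v u)) = u \<bullet> (y *v u)"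
        using pos by simp
      then show ?thesis
        using pos by (simp add: v_def matrix_vector_mult_scaleR)
    qed
    define T1 where "T1 = {x \<in> T. x \<bullet> (y *v v) = 0}"
    have T1: "subspace T1"
      using T by (auto simp: T1_def subspace_def inner_add_left)
    have T1T: "T1 \<subseteq> T" by (auto simp: T1_def)
    have null: "null_on T1 y = null_on T y"
    proof
      show "null_on T1 y \<subseteq> null_on T y"
        using T1T by (auto simp: null_on_def)
      show "null_on T y \<subseteq> null_on T1 y"
      proof
        fix x assume x: "x \<in> null_on T y"
        then have "x \<bullet> (y *v v) = 0"
          using isotropic_in_radical[OF T y x vT] sym_form_commute[OF psd_form_on_sym[OF y], of x v]
          by simp
        with x show "x \<in> null_on T1 y"
          by (simp add: null_on_def T1_def)
      qed
    qed
    have split: "x - (x \<bullet> (y *v v)) *\<^sub>R v \<in> T1" if "x \<in> T" for x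
      using that T vT v1 by (simp add: T1_def subspace_diff subspace_scale inner_diff_left)
    have span_T: "span (insert v T1) = T"
    proof
      show "span (insert v T1) \<subseteq> T"
        using T T1T vT by (intro span_minimal) auto
      show "T \<subseteq> span (insert v T1)"
        unfolding span_insert using split span_superset[of T1] by blast
    qed
    have "v \<notin> T1" using v1 by (simp add: T1_def)
    then have "dim (insert v T1) = dim T1 + 1"
      using T1 by (simp add: dim_insert span_eq_iff[THEN iffD2, OF T1])
    then have dim_T: "dim T = dim T1 + 1"
      by (metis span_T dim_span)
    then have "dim T1 < dim T" by simp
    from less.hyps[OF this T1 psd_form_on_mono[OF y T1T]] obtain es where es: "set es \<subseteq> T1"
      "\<forall>i<length es. \<forall>j<length es. es ! i \<bullet> (y *v es ! j) = (if i = j then 1 else 0)"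
      "span (set es \<union> null_on T1 y) = T1" "length es + dim (null_on T1 y) = dim T1"
      by blast
    have esv: "es ! i \<bullet> (y *v v) = 0" "v \<bullet> (y *v es ! i) = 0" if "i < length es" for i
    proof -
      show *: "es ! i \<bullet> (y *v v) = 0"
        using es(1) nth_mem[OF that] by (auto simp: T1_def)
      show "v \<bullet> (y *v es ! i) = 0"
        using * sym_form_commute[OF psd_form_on_sym[OF y], of v "es ! i"] by simp
    qed
    have "span (set (v # es) \<union> null_on T y) = span (insert v (span (set es \<union> null_on T1 y)))"
      by (simp only: null span_insert span_span list.set Un_insert_left)
    then have "span (set (v # es) \<union> null_on T y) = T"
      using es(3) span_T by simp
    moreover have "(v # es) ! i \<bullet> (y *v (v # es) ! j) = (if i = j then 1 else 0)"
      if "i < length (v # es)" "j < length (v # es)" for i j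
    proof (cases i)
      case 0
      then show ?thesis
        using that(2) esv(2) v1 by (cases j) simp_all
    next
      case (Suc i')
      then show ?thesis
        using that es(2) esv(1) by (cases j) simp_all
    qed
    moreover have "set (v # es) \<subseteq> T"
      using vT es(1) T1T by auto
    moreover have "length (v # es) + dim (null_on T y) = dim T"
      using es(4) dim_T by (simp add: null)
    ultimately show ?thesis
      by blast
  qed
qed

definition outer :: "real^'n \<Rightarrow> real^'n^'n"
  where "outer v = (\<chi> i j. v $ i * v $ j)"

lemma outer_sym: "outer v \<in> sym_mats"
  by (simp add: outer_def sym_mats_def transpose_def mult.commute)

lemma outer_mult_vec: "outer v *v w = (v \<bullet> w) *\<^sub>R v"
  by (simp add: outer_def matrix_vector_mult_def vec_eq_iff inner_vec_def
      sum_distrib_left sum_distrib_right mult_ac)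

lemma inner_outer: "outer v \<bullet> y = v \<bullet> (y *v v)"
  by (simp add: outer_def matrix_vector_mult_def inner_vec_def sum_distrib_left mult_ac)

lemma continuous_on_outer: "continuous_on S outer"
  unfolding outer_def by (intro continuous_intros)

lemma mult_vec_sum_list:
  fixes f :: "'a \<Rightarrow> real^'n^'m"
  shows "sum_list (map f xs) *v w = (\<Sum>x\<leftarrow>xs. f x *v w)"
  by (induction xs) (auto simp: matrix_vector_mult_add_rdistrib)

lemma inner_sum_list: "sum_list (map f xs) \<bullet> y = (\<Sum>x\<leftarrow>xs. f x \<bullet> y)"
  by (induction xs) (auto simp: inner_add_left)

text \<open>The faces of the semidefinite cone correspond to the subspaces of the underlying vector
  space; the face of \<open>T\<close> consists of the sums of squares \<open>v v\<^sup>T\<close> with \<open>v \<in> T\<close>.\<close>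

definition psd_face :: "(real^'n) set \<Rightarrow> (real^'n^'n) set"
  where "psd_face T = {s \<in> psd_cone. \<forall>w \<in> orthogonal_comp T. s *v w = 0}"

lemma psd_face_UNIV: "psd_face UNIV = psd_cone"
  by (simp add: psd_face_def)

lemma outer_in_psd_face: "v \<in> T \<Longrightarrow> outer v \<in> psd_face T"
  by (auto simp: psd_face_def psd_cone_def outer_sym outer_mult_vec orthogonal_comp_def
      orthogonal_def inner_commute)

text \<open>A basis that is orthonormal for the form \<open>s\<close>, up to the null space of \<open>s\<close>, yields the squares:
  \<open>s\<close> and \<open>\<Sum> (s e) (s e)\<^sup>T\<close> agree on this basis and on the null space.\<close>

lemma psd_face_sum_outer:
  fixes s :: "real^'n^'n"
  assumes T: "subspace T" and s: "s \<in> psd_face T"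
  shows "\<exists>ws. set ws \<subseteq> T \<and> s = (\<Sum>w\<leftarrow>ws. outer w)"
proof -
  have form: "psd_form_on UNIV s"
    using s by (simp add: psd_face_def psd_cone_eq)
  obtain es where es:
    "\<forall>i<length es. \<forall>j<length es. es ! i \<bullet> (s *v es ! j) = (if i = j then 1 else 0)"
    "span (set es \<union> null_on UNIV s) = UNIV"
    using gram_basis[OF subspace_UNIV form] by blast
  define r where "r = (\<Sum>w\<leftarrow>map ((*v) s) es. outer w)"
  have r: "r *v x = (\<Sum>e\<leftarrow>es. (x \<bullet> (s *v e)) *\<^sub>R (s *v e))" for x
    by (simp add: r_def mult_vec_sum_list o_def outer_mult_vec inner_commute)
  have "s *v x = r *v x" if "x \<in> set es \<union> null_on UNIV s" for x
    using that
  proof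
    assume "x \<in> set es"
    then obtain i where i: "i < length es" "x = es ! i"
      by (auto simp: in_set_conv_nth)
    have "r *v x = (\<Sum>j<length es. (x \<bullet> (s *v es ! j)) *\<^sub>R (s *v es ! j))"
      by (simp add: r sum_list_sum_nth atLeast0LessThan)
    also have "\<dots> = (\<Sum>j<length es. if j = i then s *v x else 0)"
      using es(1) i by (intro sum.cong) auto
    finally show ?thesis
      using i(1) by simp
  next
    assume x: "x \<in> null_on UNIV s"
    then have "w \<bullet> (s *v x) = 0" for w
      using isotropic_in_radical[OF subspace_UNIV form] by simp
    then have sx: "s *v x = 0"
      using inner_eq_zero_iff by blast
    moreover have "x \<bullet> (s *v w) = 0" for w
      using sx sym_form_commute[OF psd_form_on_sym[OF form], of x w] by simp
    ultimately show ?thesis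
      by (simp add: r)
  qed
  then have "s *v x = r *v x" for x
    using linear_eq_on_span[of "(*v) s" "(*v) r" "set es \<union> null_on UNIV s" x] es(2)
    by (auto simp: matrix_vector_mul_linear)
  then have "s = r"
    by (simp add: matrix_eq)
  moreover have "s *v x \<in> T" for x
  proof -
    have "w \<bullet> (s *v x) = 0" if "w \<in> orthogonal_comp T" for w
      using s that sym_form_commute[OF psd_form_on_sym[OF form], of w x]
      by (simp add: psd_face_def)
    then have "s *v x \<in> orthogonal_comp (orthogonal_comp T)"
      by (subst orthogonal_comp_def) (simp add: orthogonal_def)
    then show ?thesis
      using orthogonal_comp_self[OF T] by simp
  qed
  ultimately show ?thesis
    by (intro exI[of _ "map ((*v) s) es"]) (auto simp: r_def)
qed

lemma sum_list_nonneg_zero_member: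
  fixes f :: "'a \<Rightarrow> real"
  assumes "\<forall>x\<in>set xs. 0 \<le> f x" and "sum_list (map f xs) = 0" and "x \<in> set xs"
  shows "f x = 0"
  using assms sum_list_nonneg_eq_0_iff[of "map f xs"] by auto

lemma psd_face_inner_nonneg:
  assumes "subspace T" and "psd_form_on T y" and "s \<in> psd_face T"
  shows "0 \<le> s \<bullet> y"
proof -
  obtain ws where "set ws \<subseteq> T" "s = (\<Sum>w\<leftarrow>ws. outer w)"
    using psd_face_sum_outer[OF assms(1,3)] by blast
  then show ?thesis
    using psd_form_on_nonneg[OF assms(2)]
    by (force simp: inner_sum_list inner_outer intro!: sum_list_nonneg)
qed

text \<open>Each term of \<open>s \<bullet> y = \<Sum> w \<bullet> y w\<close> is nonnegative, so if the sum vanishes then every \<open>w\<close> is null.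
  Geometrically, the hyperplane of \<open>y\<close> supports the face of \<open>T\<close> and cuts out the face of the null
  space.\<close>

lemma psd_face_cut:
  assumes T: "subspace T" and y: "psd_form_on T y"
  shows "{s \<in> psd_face T. s \<bullet> y = 0} = psd_face (null_on T y)"
proof (intro equalityI subsetI)
  fix s assume "s \<in> {s \<in> psd_face T. s \<bullet> y = 0}"
  then have s: "s \<in> psd_face T" "s \<bullet> y = 0" by auto
  obtain ws where ws: "set ws \<subseteq> T" "s = (\<Sum>w\<leftarrow>ws. outer w)"
    using psd_face_sum_outer[OF T s(1)] by blast
  have "w \<bullet> (y *v w) = 0" if "w \<in> set ws" for w
    using that ws s(2) psd_form_on_nonneg[OF y]
    by (intro sum_list_nonneg_zero_member[of ws "\<lambda>w. w \<bullet> (y *v w)"])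
      (auto simp: inner_sum_list inner_outer)
  then have *: "w \<in> null_on T y" if "w \<in> set ws" for w
    using that ws(1) by (auto simp: null_on_def)
  have "s *v x = 0" if "x \<in> orthogonal_comp (null_on T y)" for x
  proof -
    have "map (\<lambda>w. (w \<bullet> x) *\<^sub>R w) ws = map (\<lambda>w. 0) ws"
      using that * by (auto simp: orthogonal_comp_def orthogonal_def)
    then show ?thesis
      unfolding ws(2) mult_vec_sum_list outer_mult_vec by (simp only:) simp
  qed
  then show "s \<in> psd_face (null_on T y)"
    using s(1) by (simp add: psd_face_def)
next
  fix s assume s: "s \<in> psd_face (null_on T y)"
  have sub: "null_on T y \<subseteq> T" by (auto simp: null_on_def)
  obtain ws where ws: "set ws \<subseteq> null_on T y" "s = (\<Sum>w\<leftarrow>ws. outer w)"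
    using psd_face_sum_outer[OF subspace_null_on[OF T y] s] by blast
  have "map (\<lambda>w. outer w \<bullet> y) ws = map (\<lambda>w. 0) ws"
    using ws(1) by (auto simp: inner_outer null_on_def)
  then have "s \<bullet> y = 0"
    unfolding ws(2) inner_sum_list by (simp only:) simp
  moreover have "s \<in> psd_face T"
    using s orthogonal_comp_anti_mono[OF sub] by (auto simp: psd_face_def)
  ultimately show "s \<in> {s \<in> psd_face T. s \<bullet> y = 0}" by simp
qed

section \<open>A theorem of the alternative on one face\<close>

lemma inner_transpose_left:
  fixes a x :: "real^'n^'n"
  shows "transpose a \<bullet> x = a \<bullet> transpose x"
  unfolding inner_vec_def transpose_def by (simp, rule sum.swap)

lemma form_add: "v \<bullet> ((a + b) *v v) = v \<bullet> (a *v v) + v \<bullet> (b *v v)"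
  and form_scaleR: "v \<bullet> ((r *\<^sub>R a) *v v) = r * (v \<bullet> (a *v v))"
  and form_minus: "v \<bullet> ((- a) *v v) = - (v \<bullet> (a *v v))"
  for a b :: "real^'n^'n"
  by (simp_all add: inner_outer[symmetric] inner_add_right)

lemma bounded_on_subspace_zero:
  fixes a :: "'a::real_inner"
  assumes L: "subspace L" and b: "\<forall>x\<in>L. a \<bullet> x < b" and x: "x \<in> L"
  shows "a \<bullet> x = 0"
proof (rule ccontr)
  assume n: "a \<bullet> x \<noteq> 0"
  have "((b + 1) / (a \<bullet> x)) *\<^sub>R x \<in> L"
    using L x by (rule subspace_scale)
  then have "a \<bullet> (((b + 1) / (a \<bullet> x)) *\<^sub>R x) < b"
    using b by blast
  with n show False by simp
qed

text \<open>For \<open>w\<close> orthogonal to \<open>T\<close> and any \<open>v\<close>, the symmetrized product of \<open>v\<close> and \<open>w\<close> vanishes as a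
  form on \<open>T\<close>, and orthogonality of \<open>z\<close> to it means \<open>v \<bullet> z w = 0\<close>. So \<open>z\<close> annihilates the complement
  of \<open>T\<close>, and positivity on \<open>T\<close> becomes positivity everywhere.\<close>

lemma psd_face_of_orthogonal:
  fixes z :: "real^'n^'n"
  assumes T: "subspace T" and z: "psd_form_on T z"
    and N: "\<And>x. x \<in> sym_mats \<Longrightarrow> \<forall>v\<in>T. v \<bullet> (x *v v) = 0 \<Longrightarrow> z \<bullet> x = 0"
  shows "z \<in> psd_face T"
proof -
  note sym = psd_form_on_sym[OF z]
  have zw: "z *v w = 0" if w: "w \<in> orthogonal_comp T" for w
  proof -
    have "v \<bullet> (z *v w) = 0" for v
    proof -
      define x where "x = outer (v + w) + (- outer v) + (- outer w)"
      have "x \<in> sym_mats"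
        unfolding x_def using sym_mats_scaleR[OF outer_sym, of "-1"]
        by (intro sym_mats_add outer_sym) auto
      moreover have "t \<bullet> (x *v t) = 0" if "t \<in> T" for t
      proof -
        have "t \<bullet> w = 0" "w \<bullet> t = 0"
          using w that by (auto simp: orthogonal_comp_def orthogonal_def inner_commute)
        then show ?thesis
          unfolding x_def form_add form_minus outer_mult_vec
          by (simp add: inner_add_left inner_add_right inner_commute)
      qed
      ultimately have "x \<bullet> z = 0"
        using N by (simp add: inner_commute)
      moreover have "x \<bullet> z = 2 * (v \<bullet> (z *v w))"
        unfolding x_def inner_add_left inner_minus_left inner_outer
        by (simp add: matrix_vector_right_distrib inner_add_left inner_add_right
            sym_form_commute[OF sym, of w v])
      ultimately show ?thesis by simp
    qed
    then show ?thesis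
      using inner_eq_zero_iff by blast
  qed
  have "0 \<le> v \<bullet> (z *v v)" for v
  proof -
    obtain p q where pq: "p \<in> span T" "\<And>w. w \<in> span T \<Longrightarrow> orthogonal q w" "v = p + q"
      using orthogonal_subspace_decomp_exists by blast
    have p: "p \<in> T"
      using pq(1) T by (metis span_eq_iff)
    have "q \<in> orthogonal_comp T"
      using pq(2) by (simp add: orthogonal_comp_def orthogonal_commute span_base)
    then have q: "z *v q = 0"
      by (rule zw)
    have "v \<bullet> (z *v v) = p \<bullet> (z *v p)"
      using q sym_form_commute[OF sym, of q p]
      by (simp add: pq(3) matrix_vector_right_distrib inner_add_left)
    then show ?thesis
      using psd_form_on_nonneg[OF z p] by simp
  qed
  then show ?thesis
    using zw sym by (simp add: psd_face_def psd_cone_def)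
qed

text \<open>The convex hull of \<open>- h\<close> and the unit squares of the face is compact, and by hypothesis it
  misses the closed subspace of symmetric matrices that agree as forms on \<open>T\<close> with an element of \<open>U\<close>. A
  strictly separating functional is orthogonal to \<open>U\<close>, negative at \<open>h\<close> and positive on the face.
  Including \<open>- h\<close> in the compact set avoids the question whether the sum of the cone and \<open>U\<close> is
  closed.\<close>

lemma psd_translate_or_separator:
  fixes U :: "(real^'n^'n) set"
  assumes T: "subspace T" and U: "subspace U" "U \<subseteq> sym_mats" and h: "h \<in> sym_mats"
    and noU: "\<forall>u\<in>U. psd_form_on T u \<longrightarrow> null_on T u = T"
    and noh: "\<forall>u\<in>U. \<not> psd_form_on T (h + u)"
  shows "\<exists>s\<in>psd_face T. (\<forall>u\<in>U. s \<bullet> u = 0) \<and> s \<bullet> h < 0"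
proof -
  define N where "N = {x \<in> sym_mats. \<forall>v\<in>T. v \<bullet> (x *v v) = 0}"
  define L where "L = {u + x | u x. u \<in> U \<and> x \<in> N}"
  define E where "E = outer ` (T \<inter> sphere 0 1)"
  define K where "K = convex hull (insert (- h) E)"
  have N: "subspace N"
    using subspace_sym_mats by (auto simp: N_def subspace_def form_add form_scaleR)
  have L: "subspace L"
    unfolding L_def using U(1) N by (rule subspace_sums)
  have "compact E"
    unfolding E_def using T
    by (intro compact_continuous_image continuous_on_outer closed_Int_compact closed_subspace)
      auto
  then have K: "compact K" "convex K" "- h \<in> K"
    by (auto simp: K_def compact_convex_hull hull_inc)
  have E_ne: "E \<noteq> {}"
  proof -
    have "\<exists>v\<in>T. v \<noteq> 0"
    proof (rule ccontr)
      assume "\<not> (\<exists>v\<in>T. v \<noteq> 0)"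
      then have "v = 0" if "v \<in> T" for v
        using that by blast
      then have "psd_form_on T (h + 0)"
        using h by (force simp: psd_form_on_def)
      then show False
        using noh U(1) subspace_0 by blast
    qed
    then obtain v where "v \<in> T" "v \<noteq> 0" by blast
    then have "(1 / norm v) *\<^sub>R v \<in> T \<inter> sphere 0 1"
      using T by (simp add: subspace_scale)
    then show ?thesis by (auto simp: E_def)
  qed
  \<comment> \<open>The condition of nonvanishing on \<open>T\<close> is convex because all the forms are nonnegative there.\<close>
  define B where "B = {\<beta>. psd_form_on T \<beta> \<and> (\<exists>v\<in>T. 0 < v \<bullet> (\<beta> *v v))}"
  have "convex B"
    unfolding convex_def
  proof (intro ballI allI impI)
    fix x y and a b :: real
    assume xy: "x \<in> B" "y \<in> B" and ab: "0 \<le> a" "0 \<le> b" "a + b = 1"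
    have psd: "psd_form_on T x" "psd_form_on T y"
      using xy by (auto simp: B_def)
    have "psd_form_on T (a *\<^sub>R x + b *\<^sub>R y)"
      using psd ab by (auto simp: psd_form_on_def form_add form_scaleR sym_mats_add sym_mats_scaleR)
    moreover have "\<exists>v\<in>T. 0 < v \<bullet> ((a *\<^sub>R x + b *\<^sub>R y) *v v)"
    proof (cases "a = 0")
      case True
      then show ?thesis
        using xy(2) ab by (auto simp: B_def)
    next
      case False
      obtain v where v: "v \<in> T" "0 < v \<bullet> (x *v v)"
        using xy(1) by (auto simp: B_def)
      have "0 < a * (v \<bullet> (x *v v))"
        using v(2) False ab by simp
      moreover have "0 \<le> b * (v \<bullet> (y *v v))"
        using ab psd_form_on_nonneg[OF psd(2) v(1)] by simp
      ultimately show ?thesis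
        using v(1) by (intro bexI[of _ v]) (auto simp: form_add form_scaleR)
    qed
    ultimately show "a *\<^sub>R x + b *\<^sub>R y \<in> B"
      by (simp add: B_def)
  qed
  moreover have "outer v \<in> B" if "v \<in> T" "norm v = 1" for v
  proof -
    have "v \<bullet> v = 1"
      using that(2) by (simp add: dot_square_norm)
    then have "0 < v \<bullet> (outer v *v v)"
      by (simp add: outer_mult_vec)
    moreover have "psd_form_on T (outer v)"
      by (auto simp: psd_form_on_def outer_sym outer_mult_vec inner_commute)
    ultimately show ?thesis
      using that(1) by (auto simp: B_def)
  qed
  then have "E \<subseteq> B"
    by (auto simp: E_def)
  ultimately have hull_B: "convex hull E \<subseteq> B"
    by (intro hull_minimal)
  have disj: "L \<inter> K = {}"
  proof (rule ccontr)
    assume "L \<inter> K \<noteq> {}"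
    then obtain k where k: "k \<in> L" "k \<in> K" by blast
    then obtain u x where ux: "u \<in> U" "x \<in> N" "k = u + x"
      by (auto simp: L_def)
    obtain c \<beta> where c: "0 \<le> c" "c \<le> 1" "\<beta> \<in> convex hull E" "k = (1 - c) *\<^sub>R (- h) + c *\<^sub>R \<beta>"
      using k(2) E_ne unfolding K_def convex_hull_insert_alt by auto
    have \<beta>: "psd_form_on T \<beta>" "\<exists>v\<in>T. 0 < v \<bullet> (\<beta> *v v)"
      using c(3) hull_B by (auto simp: B_def)
    have form_k: "v \<bullet> (k *v v) = v \<bullet> (u *v v)" if "v \<in> T" for v
      using ux(2,3) that by (simp add: N_def form_add)
    have form_c: "v \<bullet> (k *v v) = c * (v \<bullet> (\<beta> *v v)) - (1 - c) * (v \<bullet> (h *v v))" for v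
      unfolding c(4) form_add form_scaleR form_minus by simp
    show False
    proof (cases "c = 1")
      case True
      then have *: "v \<bullet> (u *v v) = v \<bullet> (\<beta> *v v)" if "v \<in> T" for v
        using form_k[OF that] form_c[of v] by simp
      then have "psd_form_on T u"
        using \<beta>(1) ux(1) U(2) by (auto simp: psd_form_on_def)
      then have "null_on T u = T"
        using noU ux(1) by blast
      then have "v \<bullet> (u *v v) = 0" if "v \<in> T" for v
        using that by (auto simp: null_on_def)
      then show False
        using \<beta>(2) * by force
    next
      case False
      then have c1: "0 < 1 - c" using c(2) by simp
      define u' where "u' = (1 / (1 - c)) *\<^sub>R u"
      have u': "u' \<in> U"
        using U(1) ux(1) by (simp add: u'_def subspace_scale)
      have "0 \<le> v \<bullet> ((h + u') *v v)" if "v \<in> T" for v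
      proof -
        have "(1 - c) * (v \<bullet> ((h + u') *v v)) = (1 - c) * (v \<bullet> (h *v v)) + v \<bullet> (u *v v)"
          using c1 by (simp add: u'_def form_add form_scaleR distrib_left)
        also have "\<dots> = c * (v \<bullet> (\<beta> *v v))"
          using form_k[OF that] form_c[of v] by simp
        also have "\<dots> \<ge> 0"
          using c(1) psd_form_on_nonneg[OF \<beta>(1) that] by simp
        finally show ?thesis
          using c1 by (simp add: zero_le_mult_iff)
      qed
      then have "psd_form_on T (h + u')"
        using h u' U(2) by (auto simp: psd_form_on_def sym_mats_add subsetD)
      then show False
        using noh u' by blast
    qed
  qed
  obtain a b where ab: "\<forall>x\<in>L. a \<bullet> x < b" "\<forall>x\<in>K. a \<bullet> x > b"
    using separating_hyperplane_closed_compact[OF subspace_imp_convex[OF L] closed_subspace[OF L]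
        K(2,1) _ disj] K(3) by blast
  have b: "0 < b"
    using ab(1) subspace_0[OF L] by force
  have aL: "a \<bullet> x = 0" if "x \<in> L" for x
    using bounded_on_subspace_zero[OF L ab(1) that] .
  have UL: "U \<subseteq> L" and NL: "N \<subseteq> L"
    using subspace_0[OF N] subspace_0[OF U(1)] unfolding L_def by force+
  \<comment> \<open>Only the symmetric part of the separating functional is seen by symmetric matrices.\<close>
  define z where "z = (1 / 2) *\<^sub>R (a + transpose a)"
  have z_sym: "z \<in> sym_mats"
    by (simp add: z_def sym_mats_def transpose_def vec_eq_iff)
  have z_inner: "z \<bullet> x = a \<bullet> x" if "x \<in> sym_mats" for x
    using that by (simp add: z_def inner_add_left inner_transpose_left sym_mats_def)
  have z_pos: "0 \<le> v \<bullet> (z *v v)" if "v \<in> T" for v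
  proof (cases "v = 0")
    case False
    define v' where "v' = (1 / norm v) *\<^sub>R v"
    have "outer v' \<in> E"
      using that False T by (simp add: E_def v'_def subspace_scale)
    then have "outer v' \<in> K"
      by (simp add: K_def hull_inc)
    then have "b < a \<bullet> outer v'"
      using ab(2) by blast
    then have "0 < z \<bullet> outer v'"
      using b z_inner[OF outer_sym] by simp
    then have "0 < v' \<bullet> (z *v v')"
      by (simp add: inner_commute[of z] inner_outer)
    also have "v' \<bullet> (z *v v') = (1 / norm v)\<^sup>2 * (v \<bullet> (z *v v))"
      by (simp add: v'_def matrix_vector_mult_scaleR power2_eq_square)
    finally show ?thesis
      using False by (simp add: zero_less_mult_iff)
  qed simp
  then have "psd_form_on T z"
    using z_sym by (simp add: psd_form_on_def)
  moreover have "z \<bullet> x = 0" if "x \<in> sym_mats" "\<forall>v\<in>T. v \<bullet> (x *v v) = 0" for x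
    using that aL NL z_inner by (auto simp: N_def subset_iff)
  ultimately have "z \<in> psd_face T"
    using psd_face_of_orthogonal[OF T] by blast
  moreover have "z \<bullet> u = 0" if "u \<in> U" for u
    using that aL UL U(2) z_inner by (auto simp: subset_iff)
  moreover have "z \<bullet> h < 0"
  proof -
    have "b < a \<bullet> (- h)"
      using ab(2) K(3) by blast
    then show ?thesis
      using b z_inner[OF h] by simp
  qed
  ultimately show ?thesis by blast
qed

section \<open>Facial reduction as a chain of subspaces\<close>

text \<open>A facial reduction sequence cuts the cone down to smaller and smaller faces. Each face is represented here
  by its subspace, and cutting with \<open>y\<close> replaces \<open>T\<close> by the null space of the form \<open>y\<close> on \<open>T\<close>.\<close>

fun fr_chain :: "(real^'n) set \<Rightarrow> (real^'n^'n) list \<Rightarrow> bool" where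
  "fr_chain T [] \<longleftrightarrow> True"
| "fr_chain T (y # ys) \<longleftrightarrow> psd_form_on T y \<and> fr_chain (null_on T y) ys"

fun strict_chain :: "(real^'n) set \<Rightarrow> (real^'n^'n) list \<Rightarrow> bool" where
  "strict_chain T [] \<longleftrightarrow> True"
| "strict_chain T (y # ys) \<longleftrightarrow> null_on T y \<noteq> T \<and> strict_chain (null_on T y) ys"

fun chain_space :: "(real^'n) set \<Rightarrow> (real^'n^'n) list \<Rightarrow> (real^'n) set" where
  "chain_space T [] = T"
| "chain_space T (y # ys) = chain_space (null_on T y) ys"

lemma fr_chain_append:
  "fr_chain T (xs @ ys) \<longleftrightarrow> fr_chain T xs \<and> fr_chain (chain_space T xs) ys"
  by (induction xs arbitrary: T) auto

lemma strict_chain_append: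
  "strict_chain T (xs @ ys) \<longleftrightarrow> strict_chain T xs \<and> strict_chain (chain_space T xs) ys"
  by (induction xs arbitrary: T) auto

lemma subspace_chain_space: "subspace T \<Longrightarrow> fr_chain T ys \<Longrightarrow> subspace (chain_space T ys)"
  by (induction ys arbitrary: T) (auto intro: subspace_null_on)

lemma psd_face_chain:
  assumes "subspace T" and "fr_chain T ys"
  shows "{s \<in> psd_face T. \<forall>y\<in>set ys. s \<bullet> y = 0} = psd_face (chain_space T ys)"
  using assms
proof (induction ys arbitrary: T)
  case (Cons y ys)
  then have y: "psd_form_on T y" and ys: "fr_chain (null_on T y) ys"
    by auto
  have "{s \<in> psd_face T. \<forall>x\<in>set (y # ys). s \<bullet> x = 0}
      = {s \<in> {s \<in> psd_face T. s \<bullet> y = 0}. \<forall>x\<in>set ys. s \<bullet> x = 0}"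
    by auto
  also have "\<dots> = psd_face (chain_space (null_on T y) ys)"
    unfolding psd_face_cut[OF Cons.prems(1) y]
    using Cons.IH[OF subspace_null_on[OF Cons.prems(1) y] ys] .
  finally show ?case by simp
qed simp

lemma fr_chain_sound:
  assumes "subspace T" and "fr_chain T (us @ [y])" and "s \<in> psd_face T"
    and "\<forall>u\<in>set us. s \<bullet> u = 0"
  shows "0 \<le> s \<bullet> y"
proof -
  have *: "fr_chain T us" "psd_form_on (chain_space T us) y"
    using assms(2) by (auto simp: fr_chain_append)
  have "s \<in> psd_face (chain_space T us)"
    using assms(3,4) psd_face_chain[OF assms(1) *(1)] by blast
  then show ?thesis
    using psd_face_inner_nonneg[OF subspace_chain_space[OF assms(1) *(1)] *(2)] by blast
qed

text \<open>Each strict step lowers the dimension of \<open>T\<close>, which bounds their number by \<open>dim T\<close>. The bound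
  \<open>dim T - 1\<close> comes from stopping at a line: if \<open>u\<close> is positive there, the multiple of \<open>u\<close> that cancels
  \<open>h\<close> on the line is added to \<open>h\<close> instead of being used as a member of the chain.\<close>

lemma facial_reduction:
  fixes U :: "(real^'n^'n) set"
  assumes "subspace T" and U: "subspace U" "U \<subseteq> sym_mats" and h: "h \<in> sym_mats"
    and "\<forall>s\<in>psd_face T. (\<forall>u\<in>U. s \<bullet> u = 0) \<longrightarrow> 0 \<le> s \<bullet> h"
  shows "\<exists>us u. set us \<subseteq> U \<and> u \<in> U \<and> fr_chain T (us @ [h + u]) \<and> strict_chain T us \<and>
    length us \<le> dim T - 1"
  using assms(1,5)
proof (induction "dim T" arbitrary: T rule: less_induct)
  case less
  note T = less.prems(1)
  show ?case
  proof (cases "\<exists>u\<in>U. psd_form_on T u \<and> null_on T u \<noteq> T")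
    case False
    then obtain u where "u \<in> U" "psd_form_on T (h + u)"
      using psd_translate_or_separator[OF T U h] less.prems(2) by (meson not_le)
    then show ?thesis
      by (intro exI[of _ "[]"] exI[of _ u]) simp
  next
    case True
    then obtain u where u: "u \<in> U" "psd_form_on T u" "null_on T u \<noteq> T" by blast
    define T' where "T' = null_on T u"
    have T': "subspace T'" and sub: "T' \<subseteq> T"
      using subspace_null_on[OF T u(2)] by (auto simp: T'_def null_on_def)
    have dim: "dim T' < dim T"
      using subspace_dim_equal[OF T' T sub] u(3) by (force simp: T'_def)
    show ?thesis
    proof (cases "dim T \<le> 1")
      case True
      obtain v where v: "v \<in> T" "v \<bullet> (u *v v) \<noteq> 0"
        using u(3) by (auto simp: null_on_def)
      then have "v \<noteq> 0" by auto
      then have "span {v} = T"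
        using True v(1) T by (intro subspace_dim_equal) (auto simp: span_minimal)
      define r where "r = - (v \<bullet> (h *v v)) / (v \<bullet> (u *v v))"
      have "v \<bullet> ((h + r *\<^sub>R u) *v v) = 0"
        using v(2) unfolding form_add form_scaleR r_def by simp
      then have "x \<bullet> ((h + r *\<^sub>R u) *v x) = 0" if "x \<in> T" for x
        using that unfolding \<open>span {v} = T\<close>[symmetric]
        by (auto simp: span_singleton matrix_vector_mult_scaleR)
      moreover have ru: "r *\<^sub>R u \<in> U"
        using U(1) u(1) by (rule subspace_scale)
      ultimately have "psd_form_on T (h + r *\<^sub>R u)"
        using h U(2) by (auto simp: psd_form_on_def sym_mats_add subsetD)
      then show ?thesis
        using ru by (intro exI[of _ "[]"] exI[of _ "r *\<^sub>R u"]) simp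
    next
      case False
      have "\<forall>s\<in>psd_face T'. (\<forall>u\<in>U. s \<bullet> u = 0) \<longrightarrow> 0 \<le> s \<bullet> h"
        using less.prems(2) orthogonal_comp_anti_mono[OF sub] by (auto simp: psd_face_def)
      from less.hyps[OF dim T' this]
      obtain us u' where us: "set us \<subseteq> U" "u' \<in> U" "fr_chain T' (us @ [h + u'])"
        "strict_chain T' us" "length us \<le> dim T' - 1"
        by blast
      have "length (u # us) \<le> dim T - 1"
        using us(5) dim False by simp
      then show ?thesis
        using us u by (intro exI[of _ "u # us"] exI[of _ u']) (simp add: T'_def)
    qed
  qed
qed

text \<open>In a nontrivial linear relation among the members of a strict chain, the last member with nonzero
  coefficient does not vanish on the subspace reached just before it, whereas all earlier members do.
  The induction runs from the front, with independence modulo the forms that vanish on \<open>T\<close>.\<close>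

lemma strict_chain_independent:
  fixes us :: "(real^'n^'n) list"
  assumes "strict_chain T us"
  shows "distinct us \<and> independent (set us) \<and>
    (\<forall>x\<in>span (set us). (\<forall>v\<in>T. v \<bullet> (x *v v) = 0) \<longrightarrow> x = 0)"
  using assms
proof (induction us arbitrary: T)
  case (Cons u us)
  have strict: "null_on T u \<noteq> T" and IH: "distinct us" "independent (set us)"
    "\<And>x. x \<in> span (set us) \<Longrightarrow> \<forall>v\<in>null_on T u. v \<bullet> (x *v v) = 0 \<Longrightarrow> x = 0"
    using Cons by auto
  obtain w where w: "w \<in> T" "w \<bullet> (u *v w) \<noteq> 0"
    using strict by (auto simp: null_on_def)
  then have "u \<noteq> 0" by auto
  then have u: "u \<notin> span (set us)"
    using IH(3)[of u] by (auto simp: null_on_def)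
  have "x = 0" if x: "x \<in> span (set (u # us))" "\<forall>v\<in>T. v \<bullet> (x *v v) = 0" for x
  proof -
    obtain k where k: "x - k *\<^sub>R u \<in> span (set us)"
      using x(1) by (auto simp: span_insert)
    have form: "v \<bullet> (x *v v) = v \<bullet> ((x - k *\<^sub>R u) *v v) + k * (v \<bullet> (u *v v))" for v
      by (simp add: form_add[symmetric] form_scaleR[symmetric])
    have "v \<bullet> ((x - k *\<^sub>R u) *v v) = 0" if "v \<in> null_on T u" for v
      using that x(2) form[of v] by (simp add: null_on_def)
    then have xk: "x - k *\<^sub>R u = 0"
      using IH(3)[OF k] by blast
    then have "k * (w \<bullet> (u *v w)) = 0"
      using form[of w] x(2) w(1) by simp
    with xk w(2) show ?thesis by simp
  qed
  then show ?case
    using IH(1,2) u span_base[of u "set us"] by (auto simp: independent_insert)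
qed (simp add: independent_empty)

section \<open>Chains and regularized facial reduction sequences\<close>

lemma perp_singleton: "perp {y} = {s \<in> sym_mats. s \<bullet> y = 0}"
  by (auto simp: perp_def orthogonal_comp_def orthogonal_def span_singleton inner_commute)

lemma cut_psd_cone:
  assumes "fr_chain UNIV ys"
  shows "cut psd_cone ys = psd_face (chain_space UNIV ys)"
proof -
  have "cut psd_cone ys = {s \<in> psd_face UNIV. \<forall>y\<in>set ys. s \<bullet> y = 0}"
    by (auto simp: cut_def perp_singleton psd_face_UNIV psd_cone_def)
  then show ?thesis
    using psd_face_chain[OF subspace_UNIV assms] by simp
qed

lemma dual_cone_psd_face:
  assumes "subspace T" and "psd_form_on T y"
  shows "y \<in> dual_cone (psd_face T)"
  using assms by (simp add: dual_cone_def psd_form_on_sym psd_face_inner_nonneg)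

lemma perp_psd_face:
  assumes "psd_form_on T y" and "null_on T y \<noteq> T"
  shows "y \<notin> perp (psd_face T)"
proof -
  obtain v where v: "v \<in> T" "v \<bullet> (y *v v) \<noteq> 0"
    using assms(2) by (auto simp: null_on_def)
  then have "outer v \<in> span (psd_face T)" "outer v \<bullet> y \<noteq> 0"
    by (auto simp: outer_in_psd_face span_base inner_outer)
  then show ?thesis
    by (auto simp: perp_def orthogonal_comp_def orthogonal_def)
qed

lemma fr_chain_step:
  assumes "fr_chain UNIV ys" and "i < length ys"
  shows "fr_chain UNIV (take i ys)" and "psd_form_on (chain_space UNIV (take i ys)) (ys ! i)"
    and "strict_chain UNIV ys \<Longrightarrow>
      null_on (chain_space UNIV (take i ys)) (ys ! i) \<noteq> chain_space UNIV (take i ys)"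
proof -
  have ys: "ys = take i ys @ ys ! i # drop (Suc i) ys"
    using assms(2) by (rule id_take_nth_drop)
  from assms(1) show "fr_chain UNIV (take i ys)"
    "psd_form_on (chain_space UNIV (take i ys)) (ys ! i)"
    by (subst (asm) ys, simp add: fr_chain_append)+
  assume "strict_chain UNIV ys"
  then show "null_on (chain_space UNIV (take i ys)) (ys ! i) \<noteq> chain_space UNIV (take i ys)"
    by (subst (asm) ys) (simp add: strict_chain_append)
qed

lemma fr_chain_in_FR:
  fixes ys :: "(real^'n^'n) list"
  assumes "fr_chain UNIV ys"
  shows "ys \<in> FR (length ys) psd_cone"
  using assms fr_chain_step[OF assms]
  by (auto simp: FR_def cut_psd_cone intro!: dual_cone_psd_face subspace_chain_space)

lemma strict_chain_strict_FR:
  fixes ys :: "(real^'n^'n) list"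
  assumes "fr_chain UNIV ys" and "strict_chain UNIV ys"
  shows "strict_FR psd_cone ys"
  using fr_chain_in_FR[OF assms(1)] fr_chain_step[OF assms(1)] assms(2)
  by (auto simp: strict_FR_def cut_psd_cone perp_psd_face
      intro!: dual_cone_psd_face subspace_chain_space)

lemma pre_strict_FR_chain:
  fixes us :: "(real^'n^'n) list"
  assumes "fr_chain UNIV (us @ [y])" and "strict_chain UNIV us"
  shows "pre_strict_FR psd_cone (us @ [y])"
  using fr_chain_in_FR[OF assms(1)] strict_chain_strict_FR[of us] assms
  by (simp add: pre_strict_FR_def fr_chain_append)

lemma bij_betw_ix: "bij_betw ix {..<CARD('i)} (UNIV :: 'i::{finite,linorder} set)"
  unfolding ix_def by (intro bij_betw_nth) auto

lemma inj_on_ix: "inj_on (ix :: nat \<Rightarrow> 'i::{finite,linorder}) {..<CARD('i)}"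
  using bij_betw_ix bij_betw_def by blast

lemma sum_ix: "(\<Sum>i\<in>(UNIV :: 'i::{finite,linorder} set). f i) = (\<Sum>r<CARD('i). f (ix r))"
  using sum.reindex_bij_betw[OF bij_betw_ix, of f] by simp

definition zero_before :: "nat \<Rightarrow> (real^'n::{finite,linorder}) set"
  where "zero_before s = {v. \<forall>r<CARD('n). r < s \<longrightarrow> v $ ix r = 0}"

text \<open>The prescribed entries say that the quadratic form, on the vectors with \<open>s\<close> leading zeros, is the sum
  of the next \<open>p\<close> squares.\<close>

lemma regular_block_chain_step:
  fixes y :: "real^'n::{finite,linorder}^'n::{finite,linorder}"
  assumes sym: "y \<in> sym_mats"
    and y: "\<forall>r q. s \<le> r \<and> r < CARD('n) \<and> s \<le> q \<and> q < CARD('n) \<longrightarrow>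
      y $ ix r $ ix q = (if r = q \<and> r < s + p then 1 else 0)"
  shows "psd_form_on (zero_before s) y" and "null_on (zero_before s) y = zero_before (s + p)"
proof -
  have form: "v \<bullet> (y *v v) = (\<Sum>r<CARD('n). if s \<le> r \<and> r < s + p then (v $ ix r)\<^sup>2 else 0)"
    if v: "v \<in> zero_before s" for v
  proof -
    have entry: "v $ ix r * (y $ ix r $ ix q * v $ ix q) =
        (if q = r then (if s \<le> r \<and> r < s + p then (v $ ix r)\<^sup>2 else 0) else 0)"
      if "r < CARD('n)" "q < CARD('n)" for r q
    proof (cases "s \<le> r \<and> s \<le> q")
      case True
      then show ?thesis
        using y that by (auto simp: power2_eq_square)
    next
      case False
      then show ?thesis
        using v that by (auto simp: zero_before_def)
    qed
    have "v \<bullet> (y *v v) = (\<Sum>r<CARD('n). \<Sum>q<CARD('n). v $ ix r * (y $ ix r $ ix q * v $ ix q))"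
      by (simp add: inner_vec_def matrix_vector_mult_def sum_ix sum_distrib_left)
    also have "\<dots> = (\<Sum>r<CARD('n). \<Sum>q<CARD('n).
        if q = r then (if s \<le> r \<and> r < s + p then (v $ ix r)\<^sup>2 else 0) else 0)"
      using entry by (intro sum.cong refl) simp
    finally show ?thesis
      by (simp add: sum.delta)
  qed
  show "psd_form_on (zero_before s) y"
    using sym by (auto simp: psd_form_on_def form intro!: sum_nonneg)
  have "(v \<bullet> (y *v v) = 0) \<longleftrightarrow> (\<forall>r<CARD('n). s \<le> r \<and> r < s + p \<longrightarrow> v $ ix r = 0)"
    if "v \<in> zero_before s" for v
    unfolding form[OF that] by (subst sum_nonneg_eq_0_iff) auto
  then show "null_on (zero_before s) y = zero_before (s + p)"
    by (fastforce simp: null_on_def zero_before_def)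
qed

text \<open>The offset \<open>s\<close> counts the coordinates used up by members already removed from the front.\<close>

lemma regular_blocks_chain:
  fixes ys :: "(real^'n::{finite,linorder}^'n::{finite,linorder}) list"
  assumes "length ps = length ys" and "set ys \<subseteq> sym_mats"
    and "\<forall>i<length ys. \<forall>r q. s + sum_list (take i ps) \<le> r \<and> r < CARD('n) \<and>
      s + sum_list (take i ps) \<le> q \<and> q < CARD('n) \<longrightarrow>
      ys ! i $ ix r $ ix q = (if r = q \<and> r < s + sum_list (take i ps) + ps ! i then 1 else 0)"
  shows "fr_chain (zero_before s) ys"
  using assms
proof (induction ys arbitrary: s ps)
  case (Cons y ys)
  obtain p ps' where ps: "ps = p # ps'"
    using Cons.prems(1) by (cases ps) auto
  have y: "\<forall>r q. s \<le> r \<and> r < CARD('n) \<and> s \<le> q \<and> q < CARD('n) \<longrightarrow>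
      y $ ix r $ ix q = (if r = q \<and> r < s + p then 1 else 0)"
    using Cons.prems(3)[rule_format, of 0] ps by simp
  have sym: "y \<in> sym_mats" using Cons.prems(2) by simp
  have "fr_chain (zero_before (s + p)) ys"
  proof (rule Cons.IH[of ps'])
    show "length ps' = length ys" "set ys \<subseteq> sym_mats"
      using Cons.prems ps by auto
    show "\<forall>i<length ys. \<forall>r q. s + p + sum_list (take i ps') \<le> r \<and> r < CARD('n) \<and>
      s + p + sum_list (take i ps') \<le> q \<and> q < CARD('n) \<longrightarrow>
      ys ! i $ ix r $ ix q = (if r = q \<and> r < s + p + sum_list (take i ps') + ps' ! i then 1 else 0)"
    proof (intro allI impI)
      fix i r q
      assume "i < length ys" "s + p + sum_list (take i ps') \<le> r \<and> r < CARD('n) \<and>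
        s + p + sum_list (take i ps') \<le> q \<and> q < CARD('n)"
      then show "ys ! i $ ix r $ ix q =
          (if r = q \<and> r < s + p + sum_list (take i ps') + ps' ! i then 1 else 0)"
        using Cons.prems(3)[rule_format, of "Suc i" r q] ps by (simp add: add.assoc)
    qed
  qed
  then show ?case
    using regular_block_chain_step[OF sym y] by simp
qed simp

lemma REGFR_fr_chain:
  assumes "ys \<in> REGFR k"
  shows "fr_chain UNIV ys"
proof -
  obtain p where "length p = length ys" "set ys \<subseteq> sym_mats"
    "\<forall>i<length ys. \<forall>r q. 0 + sum_list (take i p) \<le> r \<and> r < CARD('a) \<and>
      0 + sum_list (take i p) \<le> q \<and> q < CARD('a) \<longrightarrow>
      ys ! i $ ix r $ ix q = (if r = q \<and> r < 0 + sum_list (take i p) + p ! i then 1 else 0)"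
    using assms unfolding REGFR_def Let_def by auto
  then have "fr_chain (zero_before 0) ys"
    by (rule regular_blocks_chain)
  then show ?thesis
    by (simp add: zero_before_def)
qed

text \<open>An orthonormal system for the first form is followed by a basis adapted to the rest of the chain. The
  latter lies in the null space of the first form, so for this form it is orthogonal to everything,
  which gives the zero blocks.\<close>

lemma adapted_basis:
  fixes ys :: "(real^'n^'n) list"
  assumes "subspace T" and "fr_chain T ys"
  shows "\<exists>bs ps. length bs = dim T \<and> span (set bs) = T \<and>
    length ps = length ys \<and> sum_list ps \<le> dim T \<and>
    (\<forall>i<length ys. \<forall>r q. sum_list (take i ps) \<le> r \<and> r < dim T \<and>
      sum_list (take i ps) \<le> q \<and> q < dim T \<longrightarrow>
      bs ! r \<bullet> (ys ! i *v bs ! q) = (if r = q \<and> r < sum_list (take i ps) + ps ! i then 1 else 0))"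
  using assms
proof (induction ys arbitrary: T)
  case Nil
  obtain B where B: "B \<subseteq> T" "independent B" "T \<subseteq> span B" "card B = dim T"
    using basis_exists by blast
  moreover obtain bs where "set bs = B" "distinct bs"
    using finite_distinct_list[OF independent_imp_finite[OF B(2)]] by blast
  moreover have "span B = T"
    using B(1,3) Nil.prems(1) span_minimal by blast
  ultimately show ?case
    by (intro exI[of _ bs] exI[of _ "[]"]) (auto simp: distinct_card)
next
  case (Cons y ys)
  note T = Cons.prems(1)
  define T' where "T' = null_on T y"
  have y: "psd_form_on T y" and chain: "fr_chain T' ys"
    using Cons.prems(2) by (auto simp: T'_def)
  have T': "subspace T'"
    unfolding T'_def by (rule subspace_null_on[OF T y])
  obtain es where es: "set es \<subseteq> T"
    "\<forall>i<length es. \<forall>j<length es. es ! i \<bullet> (y *v es ! j) = (if i = j then 1 else 0)"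
    "span (set es \<union> T') = T" "length es + dim T' = dim T"
    using gram_basis[OF T y] unfolding T'_def by blast
  obtain bs ps where bs: "length bs = dim T'" "span (set bs) = T'"
    "length ps = length ys" "sum_list ps \<le> dim T'"
    "\<And>i r q. i < length ys \<Longrightarrow> sum_list (take i ps) \<le> r \<and> r < dim T' \<and>
      sum_list (take i ps) \<le> q \<and> q < dim T' \<Longrightarrow>
      bs ! r \<bullet> (ys ! i *v bs ! q) = (if r = q \<and> r < sum_list (take i ps) + ps ! i then 1 else 0)"
    using Cons.IH[OF T' chain] by blast
  define cs where "cs = es @ bs"
  have null: "cs ! r \<in> null_on T y" if "length es \<le> r" "r < dim T" for r
  proof -
    have "cs ! r \<in> set bs"
      using that es(4) bs(1) by (simp add: cs_def nth_append)
    then show ?thesis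
      using bs(2) span_base by (auto simp: T'_def)
  qed
  have cs_T: "cs ! r \<in> T" if "r < dim T" for r
    using that es(1) null[of r] nth_mem[of r es]
    by (cases "r < length es") (auto simp: cs_def nth_append null_on_def)
  have "span (set cs) = T"
  proof -
    have "span (set cs) = span (set es \<union> span (set bs))"
      by (simp add: cs_def span_Un[of _ "set bs"] span_Un[of _ "span (set bs)"] span_span)
    then show ?thesis
      using bs(2) es(3) by simp
  qed
  moreover have "cs ! r \<bullet> ((y # ys) ! i *v cs ! q) =
      (if r = q \<and> r < sum_list (take i (length es # ps)) + (length es # ps) ! i then 1 else 0)"
    if i: "i < length (y # ys)" and rq: "sum_list (take i (length es # ps)) \<le> r" "r < dim T"
      "sum_list (take i (length es # ps)) \<le> q" "q < dim T" for i r q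
  proof (cases i)
    case 0
    show ?thesis
    proof (cases "r < length es \<and> q < length es")
      case True
      then show ?thesis
        using es(2) 0 by (simp add: cs_def nth_append)
    next
      case False
      then have "cs ! r \<bullet> (y *v cs ! q) = 0"
      proof (cases "q < length es")
        case True
        with False have "length es \<le> r" by simp
        then have "cs ! q \<bullet> (y *v cs ! r) = 0"
          using isotropic_in_radical[OF T y null cs_T] rq by simp
        then show ?thesis
          using sym_form_commute[OF psd_form_on_sym[OF y], of "cs ! q" "cs ! r"] by simp
      next
        case False
        then show ?thesis
          using isotropic_in_radical[OF T y null cs_T] rq by simp
      qed
      with False 0 show ?thesis by auto
    qed
  next
    case (Suc j)
    define r' q' where "r' = r - length es" and "q' = q - length es"
    have le: "length es \<le> r" "length es \<le> q"
      using rq Suc by auto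
    have "cs ! r = bs ! r'" "cs ! q = bs ! q'"
      using le by (auto simp: cs_def nth_append r'_def q'_def)
    moreover have "bs ! r' \<bullet> (ys ! j *v bs ! q') =
        (if r' = q' \<and> r' < sum_list (take j ps) + ps ! j then 1 else 0)"
      using i rq Suc es(4) by (intro bs(5)) (auto simp: r'_def q'_def)
    moreover have "(r' = q' \<and> r' < sum_list (take j ps) + ps ! j) \<longleftrightarrow>
        (r = q \<and> r < length es + sum_list (take j ps) + ps ! j)"
      using le by (auto simp: r'_def q'_def)
    ultimately show ?thesis
      using Suc by simp
  qed
  moreover have "length cs = dim T" "length (length es # ps) = length (y # ys)"
    "sum_list (length es # ps) \<le> dim T"
    using es(4) bs(1,3,4) by (auto simp: cs_def)
  ultimately show ?case
    by (intro exI[of _ cs] exI[of _ "length es # ps"]) blast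
qed

definition congr :: "real^'n^'n \<Rightarrow> real^'n^'n \<Rightarrow> real^'n^'n"
  where "congr t y = transpose t ** y ** t"

lemma congr_vec: "congr t y *v w = transpose t *v (y *v (t *v w))"
  by (simp add: congr_def matrix_vector_mul_assoc matrix_mul_assoc)

lemma congr_mult_vec: "v \<bullet> (congr t y *v w) = (t *v v) \<bullet> (y *v (t *v w))"
proof -
  have "v \<bullet> (congr t y *v w) = ((y *v (t *v w)) v* t) \<bullet> v"
    by (simp add: congr_vec transpose_matrix_vector inner_commute)
  also have "\<dots> = (t *v v) \<bullet> (y *v (t *v w))"
    by (subst dot_lmul_matrix) (rule inner_commute)
  finally show ?thesis .
qed

lemma congr_sym: "y \<in> sym_mats \<Longrightarrow> congr t y \<in> sym_mats"
  by (simp add: congr_def sym_mats_def matrix_transpose_mul matrix_mul_assoc)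

lemma congr_psd: "y \<in> psd_cone \<Longrightarrow> congr t y \<in> psd_cone"
  by (simp add: psd_cone_def congr_sym congr_mult_vec)

lemma congr_congr: "congr t (congr s y) = congr (s ** t) y"
  by (simp add: congr_def matrix_transpose_mul matrix_mul_assoc)

lemma congr_mat_1: "congr (mat 1) y = y"
  by (simp add: congr_def)

lemma linear_congr: "linear (congr t)"
proof -
  have "congr t (a + b) = congr t a + congr t b" "congr t (r *\<^sub>R a) = r *\<^sub>R congr t a" for a b r
    by (simp_all add: matrix_eq congr_vec matrix_vector_mult_add_rdistrib matrix_vector_right_distrib
        matrix_vector_mult_scaleR flip: scaleR_matrix_vector_assoc)
  then show ?thesis
    by (intro linearI)
qed

lemma congr_inner: "congr t a \<bullet> s = a \<bullet> congr (transpose t) s"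
proof -
  have right: "(x ** t) \<bullet> s = x \<bullet> (s ** transpose t)" for x t s :: "real^'n^'n"
  proof -
    have "(x ** t) \<bullet> s = (\<Sum>i\<in>UNIV. \<Sum>j\<in>UNIV. \<Sum>k\<in>UNIV. x $ i $ k * t $ k $ j * s $ i $ j)"
      by (simp add: inner_vec_def matrix_matrix_mult_def sum_distrib_right)
    also have "\<dots> = (\<Sum>i\<in>UNIV. \<Sum>k\<in>UNIV. \<Sum>j\<in>UNIV. x $ i $ k * t $ k $ j * s $ i $ j)"
      by (rule sum.cong[OF refl]) (rule sum.swap)
    also have "\<dots> = x \<bullet> (s ** transpose t)"
      by (simp add: inner_vec_def matrix_matrix_mult_def transpose_def sum_distrib_left mult_ac)
    finally show ?thesis .
  qed
  have left: "(t ** x) \<bullet> s = x \<bullet> (transpose t ** s)" for x t s :: "real^'n^'n"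
  proof -
    have "(t ** x) \<bullet> s = (transpose x ** transpose t) \<bullet> transpose s"
      by (simp add: inner_transpose_left flip: matrix_transpose_mul)
    also have "\<dots> = transpose x \<bullet> transpose (transpose t ** s)"
      by (simp only: right transpose_transpose matrix_transpose_mul)
    finally show ?thesis
      by (simp add: inner_transpose_left)
  qed
  show ?thesis
    unfolding congr_def right[of "transpose t ** a"] left[of "transpose t" a]
    by (simp add: matrix_mul_assoc)
qed

lemma null_on_congr: "null_on {v. t *v v \<in> T} (congr t y) = {v. t *v v \<in> null_on T y}"
  by (simp add: null_on_def congr_mult_vec)

lemma fr_chain_congr: "fr_chain T ys \<Longrightarrow> fr_chain {v. t *v v \<in> T} (map (congr t) ys)"
  by (induction ys arbitrary: T) (auto simp: psd_form_on_def congr_sym congr_mult_vec null_on_congr)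

lemma strict_chain_congr:
  assumes "surj ((*v) t)" and "strict_chain T ys"
  shows "strict_chain {v. t *v v \<in> T} (map (congr t) ys)"
  using assms(2)
proof (induction ys arbitrary: T)
  case (Cons y ys)
  obtain w where w: "w \<in> T" "w \<notin> null_on T y"
    using Cons.prems by (auto simp: null_on_def)
  moreover obtain v where "w = t *v v"
    using surjD[OF assms(1)] by blast
  ultimately have "{v. t *v v \<in> null_on T y} \<noteq> {v. t *v v \<in> T}"
    by blast
  then show ?case
    using Cons by (simp add: null_on_congr)
qed simp

lemma regularizing_congruence:
  fixes ys :: "(real^'n::{finite,linorder}^'n::{finite,linorder}) list"
  assumes chain: "fr_chain UNIV ys"
  shows "\<exists>t. invertible t \<and> map (congr t) ys \<in> REGFR (length ys)"
proof -
  obtain bs ps where bs: "length bs = CARD('n)" "span (set bs) = UNIV"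
    "length ps = length ys" "sum_list ps \<le> CARD('n)"
    "\<And>i r q. i < length ys \<Longrightarrow> sum_list (take i ps) \<le> r \<and> r < CARD('n) \<and>
      sum_list (take i ps) \<le> q \<and> q < CARD('n) \<Longrightarrow>
      bs ! r \<bullet> (ys ! i *v bs ! q) = (if r = q \<and> r < sum_list (take i ps) + ps ! i then 1 else 0)"
    using adapted_basis[OF subspace_UNIV chain] unfolding dim_UNIV DIM_cart by auto
  \<comment> \<open>The adapted basis vectors are the columns of \<open>t\<close>, in the order of the positions of the indices.\<close>
  define t where "t = (\<chi> i j. bs ! (the_inv_into {..<CARD('n)} ix (j :: 'n)) $ i)"
  have col: "t *v axis (ix r) 1 = bs ! r" if "r < CARD('n)" for r
  proof -
    have "the_inv_into {..<CARD('n)} ix (ix r :: 'n) = r"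
      by (rule the_inv_into_f_f[OF inj_on_ix]) (use that in simp)
    then show ?thesis
      by (simp add: t_def matrix_vector_mult_basis column_def vec_eq_iff)
  qed
  have "set bs \<subseteq> range ((*v) t)"
    using bs(1) col by (metis in_set_conv_nth rangeI subsetI)
  then have "span (set bs) \<subseteq> range ((*v) t)"
    by (intro span_minimal linear_subspace_image subspace_UNIV matrix_vector_mul_linear)
  then have "surj ((*v) t)"
    using bs(2) by blast
  then have "invertible t"
    by (simp add: invertible_right_inverse matrix_right_invertible_surjective)
  moreover have "set (map (congr t) ys) \<subseteq> sym_mats"
  proof -
    have "psd_form_on (chain_space UNIV (take i ys)) (ys ! i)" if "i < length ys" for i
      using fr_chain_step(2)[OF chain that] .
    then have "set ys \<subseteq> sym_mats"
      using psd_form_on_sym by (fastforce simp: in_set_conv_nth)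
    then show ?thesis
      by (auto simp: congr_sym)
  qed
  moreover have "map (congr t) ys ! i $ ix r $ ix q =
      (if r = q \<and> r < sum_list (take i ps) + ps ! i then 1 else 0)"
    if "i < length ys" "sum_list (take i ps) \<le> r \<and> r < CARD('n) \<and>
      sum_list (take i ps) \<le> q \<and> q < CARD('n)" for i r q
  proof -
    have "congr t (ys ! i) $ ix r $ ix q = axis (ix r) 1 \<bullet> (congr t (ys ! i) *v axis (ix q) 1)"
      by (simp add: matrix_vector_mult_basis column_def inner_axis')
    also have "\<dots> = bs ! r \<bullet> (ys ! i *v bs ! q)"
      using that(2) col by (simp add: congr_mult_vec)
    also have "\<dots> = (if r = q \<and> r < sum_list (take i ps) + ps ! i then 1 else 0)"
      by (rule bs(5)[OF that])
    finally show ?thesis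
      using that(1) by simp
  qed
  ultimately show ?thesis
    using bs(3,4) unfolding REGFR_def Let_def
    by (intro exI[of _ t] conjI) auto
qed

text \<open>The common core of the four existence statements. The system in question enters only through the
  choice of \<open>U\<close> and \<open>h\<close>; the hypothesis on \<open>s\<close> is its infeasibility or lack of strong infeasibility.
  Since a congruence acts on the chain by substituting \<open>t v\<close> for \<open>v\<close>, the rotated list inherits
  strictness from the chain of null spaces.\<close>

lemma regularized_certificate:
  fixes U :: "(real^'n::{finite,linorder}^'n::{finite,linorder}) set"
  assumes U: "subspace U" "U \<subseteq> sym_mats" and h: "h \<in> sym_mats"
    and "\<forall>s\<in>psd_cone. (\<forall>u\<in>U. s \<bullet> u = 0) \<longrightarrow> 0 \<le> s \<bullet> h"
  obtains us u t where "set us \<subseteq> U" "u \<in> U" "distinct us" "independent (set us)"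
    "length us \<le> CARD('n) - 1" "invertible t"
    "map (congr t) (us @ [h + u]) \<in> REGFR (length us + 1)"
    "pre_strict_FR psd_cone (map (congr t) (us @ [h + u]))"
proof -
  obtain us u where us: "set us \<subseteq> U" "u \<in> U" "fr_chain UNIV (us @ [h + u])"
    "strict_chain UNIV us" "length us \<le> CARD('n) - 1"
    using facial_reduction[OF subspace_UNIV U h] assms(4)
    unfolding psd_face_UNIV dim_UNIV DIM_cart by auto
  obtain t where t: "invertible t" "map (congr t) (us @ [h + u]) \<in> REGFR (length us + 1)"
    using regularizing_congruence[OF us(3)] by auto
  have "surj ((*v) t)"
    using t(1) by (simp add: invertible_right_inverse matrix_right_invertible_surjective)
  then have "pre_strict_FR psd_cone (map (congr t) us @ [congr t (h + u)])"
    using fr_chain_congr[OF us(3), of t] strict_chain_congr[OF _ us(4), of t]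
    by (intro pre_strict_FR_chain) auto
  then show ?thesis
    using that us t strict_chain_independent[OF us(4)] by auto
qed

text \<open>Weak duality: the orthogonality conditions confine \<open>s\<close> to the last face of
  the chain, on which the last member is nonnegative.\<close>

lemma REGFR_sound:
  assumes "us @ [y] \<in> REGFR k" and "s \<in> psd_cone" and "\<forall>u\<in>set us. s \<bullet> u = 0"
  shows "0 \<le> s \<bullet> y"
  using fr_chain_sound[OF subspace_UNIV REGFR_fr_chain[OF assms(1)]] assms(2,3)
  by (simp add: psd_face_UNIV)

lemma congruence_pairing:
  fixes t :: "real^'n^'n"
  assumes "invertible t"
  obtains t' where "invertible t'" "\<forall>a y. congr t' a \<bullet> congr t y = a \<bullet> y"
proof -
  obtain s where s: "t ** s = mat 1" "s ** t = mat 1"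
    using assms unfolding invertible_def by blast
  have "invertible (transpose s)"
    using s by (intro transpose_invertible) (auto simp: invertible_def)
  moreover have "congr (transpose s) a \<bullet> congr t y = a \<bullet> y" for a y :: "real^'n^'n"
    by (simp add: congr_inner congr_congr s congr_mat_1)
  ultimately show ?thesis
    using that by blast
qed

section \<open>Reformulations as changes of coordinates\<close>

lemma linear_eq_of_cols:
  fixes F :: "real^'m \<Rightarrow> real^'n^'n"
  assumes "linear F" and "\<And>h. a h = F (axis h 1)"
  shows "of_cols a = F"
proof
  fix x
  have "F x = F (\<Sum>i\<in>UNIV. x $ i *\<^sub>R axis i 1)"
    using basis_expansion[of x] by (simp add: scalar_mult_eq_scaleR)
  also have "\<dots> = of_cols a x"
    using assms by (simp add: of_cols_def linear_sum linear_scale)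
  finally show "of_cols a x = F x" by simp
qed

lemma adjoint_eqI:
  fixes F :: "'a::euclidean_space \<Rightarrow> 'b::euclidean_space"
  assumes "linear F" and "\<And>x. F x \<bullet> y = x \<bullet> z"
  shows "adjoint F y = z"
proof -
  have "\<forall>x. x \<bullet> adjoint F y = x \<bullet> z"
    using assms by (simp add: adjoint_works)
  then show ?thesis
    by (simp add: vector_eq_ldot)
qed

lemma adjoint_compose:
  fixes F :: "'a::euclidean_space \<Rightarrow> 'b::euclidean_space" and G :: "'c::euclidean_space \<Rightarrow> 'a"
  assumes "linear F" and "linear G"
  shows "adjoint (\<lambda>x. F (G x)) y = adjoint G (adjoint F y)"
  using linear_compose[OF assms(2,1)] assms
  by (intro adjoint_eqI) (simp_all add: o_def adjoint_works)

text \<open>This map sends the \<open>i\<close>-th unit vector to \<open>l\<close> and fixes the others, and the next one exchanges the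
  \<open>i\<close>-th and the \<open>j\<close>-th; composing \<open>A\<close> with them performs the operations on columns.\<close>

definition replace_basis :: "'m \<Rightarrow> real^'m \<Rightarrow> real^'m \<Rightarrow> real^'m"
  where "replace_basis i l x = x + x $ i *\<^sub>R (l - axis i 1)"

definition switch_basis :: "'m \<Rightarrow> 'm \<Rightarrow> real^'m \<Rightarrow> real^'m"
  where "switch_basis i j x = x + (x $ j - x $ i) *\<^sub>R (axis i 1 - axis j 1)"

lemma linear_replace_basis: "linear (replace_basis i l)"
  and linear_switch_basis: "linear (switch_basis i j)"
  by (auto intro!: linearI simp: replace_basis_def switch_basis_def algebra_simps)

lemma inj_replace_basis:
  assumes "l $ i \<noteq> 0"
  shows "inj (replace_basis i l)"
proof -
  have "x = 0" if x: "replace_basis i l x = 0" for x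
  proof -
    have "x $ i * l $ i = replace_basis i l x $ i"
      by (simp add: replace_basis_def algebra_simps)
    then have "x $ i = 0"
      using x assms by simp
    then show ?thesis
      using x by (simp add: replace_basis_def)
  qed
  then show ?thesis
    using linear_injective_0[OF linear_replace_basis] by blast
qed

lemma inj_switch_basis: "inj (switch_basis i j)"
proof -
  have "switch_basis i j (switch_basis i j x) = x" for x
    by (cases "i = j") (auto simp: switch_basis_def vec_eq_iff axis_def)
  then show ?thesis
    by (metis injI)
qed

lemma replace_col_eq:
  fixes A :: "real^'m \<Rightarrow> real^'n^'n"
  assumes "linear A"
  shows "of_cols ((cols A)(i := A l)) = (\<lambda>x. A (replace_basis i l x))"
    and "(\<chi> h. if h = i then c \<bullet> l else c $ h) = adjoint (replace_basis i l) c"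
proof -
  have "linear (\<lambda>x. A (replace_basis i l x))"
    using linear_compose[OF linear_replace_basis assms] by (simp add: o_def)
  then show "of_cols ((cols A)(i := A l)) = (\<lambda>x. A (replace_basis i l x))"
    by (rule linear_eq_of_cols) (auto simp: cols_def replace_basis_def axis_def)
  have "(\<chi> h. if h = i then c \<bullet> l else c $ h) = c + (c \<bullet> l - c $ i) *\<^sub>R axis i 1"
    by (auto simp: vec_eq_iff axis_def)
  also have "\<dots> = adjoint (replace_basis i l) c"
    by (intro adjoint_eqI[symmetric] linear_replace_basis)
      (simp add: replace_basis_def inner_add_left inner_add_right inner_diff_left inner_axis
        inner_axis' inner_commute algebra_simps)
  finally show "(\<chi> h. if h = i then c \<bullet> l else c $ h) = adjoint (replace_basis i l) c" .
qed

lemma switch_cols_eq: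
  fixes A :: "real^'m \<Rightarrow> real^'n^'n"
  assumes "linear A" and "i \<noteq> j"
  shows "of_cols ((cols A)(i := cols A j, j := cols A i)) = (\<lambda>x. A (switch_basis i j x))"
    and "(\<chi> h. if h = i then c $ j else if h = j then c $ i else c $ h) = adjoint (switch_basis i j) c"
proof -
  have "linear (\<lambda>x. A (switch_basis i j x))"
    using linear_compose[OF linear_switch_basis assms(1)] by (simp add: o_def)
  then show "of_cols ((cols A)(i := cols A j, j := cols A i)) = (\<lambda>x. A (switch_basis i j x))"
    using assms(2) by (rule_tac linear_eq_of_cols) (auto simp: cols_def switch_basis_def axis_def)
  have "(\<chi> h. if h = i then c $ j else if h = j then c $ i else c $ h)
      = c + (c $ j - c $ i) *\<^sub>R (axis i 1 - axis j 1)"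
    using assms(2) by (auto simp: vec_eq_iff axis_def)
  also have "\<dots> = adjoint (switch_basis i j) c"
    by (intro adjoint_eqI[symmetric] linear_switch_basis)
      (simp add: switch_basis_def inner_add_left inner_add_right inner_diff_left inner_diff_right
        inner_axis inner_axis' algebra_simps)
  finally show "(\<chi> h. if h = i then c $ j else if h = j then c $ i else c $ h)
      = adjoint (switch_basis i j) c" .
qed

lemma rotate_eq:
  fixes A :: "real^'m \<Rightarrow> real^'n^'n"
  assumes "linear A"
  shows "of_cols (\<lambda>i. transpose t ** cols A i ** t) = (\<lambda>x. congr t (A x))"
  using linear_compose[OF assms linear_congr]
  by (intro linear_eq_of_cols) (auto simp: o_def congr_def cols_def)

text \<open>A closed form for the effect of any sequence of operations. The shift of \<open>b\<close> is expressed in the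
  original columns, because later shifts can be pulled back through \<open>M\<close> and \<open>t\<close>.\<close>

definition coordinate_change ::
    "('m::finite, 'n::finite) sdp_data \<Rightarrow> ('m, 'n) sdp_data \<Rightarrow> bool"
  where "coordinate_change d d' \<longleftrightarrow> (case d of (A, b, c) \<Rightarrow>
    \<exists>M u t. linear M \<and> inj M \<and> invertible t \<and>
      d' = (\<lambda>x. congr t (A (M x)), congr t (b + A u), adjoint M c))"

lemma coordinate_changeE:
  assumes "coordinate_change (A, b, c) (A', b', c')"
  obtains M u t where "linear M" "inj M" "invertible t" "A' = (\<lambda>x. congr t (A (M x)))"
    "b' = congr t (b + A u)" "c' = adjoint M c"
  using assms by (auto simp: coordinate_change_def)

lemma adjoint_ident: "adjoint (\<lambda>x. x) c = c" for c :: "'a::euclidean_space"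
  by (rule adjoint_eqI) (simp_all add: linear_iff)

lemma invertible_mat_1: "invertible (mat 1 :: real^'n^'n)"
  unfolding invertible_def by (intro exI[of _ "mat 1"]) simp

lemma reform_step_coordinate_change:
  assumes "reform_step (A, b, c) d'" and A: "linear A"
  shows "coordinate_change (A, b, c) d'"
  using assms(1)
proof (cases rule: reform_step.cases)
  case (replace_col l i)
  then show ?thesis
    unfolding coordinate_change_def prod.case replace_col_eq[OF A]
    by (intro exI[of _ "replace_basis i l"] exI[of _ 0] exI[of _ "mat 1"])
      (simp add: linear_replace_basis inj_replace_basis congr_mat_1 linear_0[OF A] invertible_mat_1)
next
  case (switch_cols i j)
  then show ?thesis
    unfolding coordinate_change_def prod.case switch_cols_eq[OF A switch_cols(2)]
    by (intro exI[of _ "switch_basis i j"] exI[of _ 0] exI[of _ "mat 1"])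
      (simp add: linear_switch_basis inj_switch_basis congr_mat_1 linear_0[OF A] invertible_mat_1)
next
  case (shift_rhs u)
  then show ?thesis
    unfolding coordinate_change_def prod.case
    by (intro exI[of _ "\<lambda>x. x"] exI[of _ u] exI[of _ "mat 1"])
      (simp add: congr_mat_1 adjoint_ident linear_ident invertible_mat_1)
next
  case (rotate t)
  then show ?thesis
    unfolding coordinate_change_def prod.case rotate_eq[OF A]
    by (intro exI[of _ "\<lambda>x. x"] exI[of _ 0] exI[of _ t])
      (simp add: congr_def adjoint_ident linear_ident linear_0[OF A])
qed

lemma coordinate_change_trans:
  assumes A: "linear A" and "coordinate_change (A, b, c) (A1, b1, c1)"
    and "coordinate_change (A1, b1, c1) (A2, b2, c2)"
  shows "coordinate_change (A, b, c) (A2, b2, c2)"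
proof -
  obtain M u t where 1: "linear M" "inj M" "invertible t" "A1 = (\<lambda>x. congr t (A (M x)))"
    "b1 = congr t (b + A u)" "c1 = adjoint M c"
    using assms(2) by (rule coordinate_changeE)
  obtain M' u' t' where 2: "linear M'" "inj M'" "invertible t'" "A2 = (\<lambda>x. congr t' (A1 (M' x)))"
    "b2 = congr t' (b1 + A1 u')" "c2 = adjoint M' c1"
    using assms(3) by (rule coordinate_changeE)
  have "b1 + A1 u' = congr t (b + A (u + M u'))"
    unfolding 1 by (simp add: linear_add[OF A] linear_add[OF linear_congr] add.assoc)
  then show ?thesis
    unfolding coordinate_change_def prod.case
    using 1 2 linear_compose[OF 2(1) 1(1)] inj_compose[OF 1(2) 2(2)] invertible_mult[OF 1(3) 2(3)]
    by (intro exI[of _ "\<lambda>x. M (M' x)"] exI[of _ "u + M u'"] exI[of _ "t ** t'"])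
      (simp add: o_def congr_congr adjoint_compose)
qed

lemma coordinate_change_linear:
  assumes "linear A" and "coordinate_change (A, b, c) (A', b', c')"
  shows "linear A'"
proof -
  obtain M t where "linear M" "A' = (\<lambda>x. congr t (A (M x)))"
    using assms(2) by (rule coordinate_changeE)
  then show ?thesis
    using linear_compose[OF linear_compose[OF _ assms(1)] linear_congr[of t]] by (simp add: o_def)
qed

lemma reformulation_coordinate_change:
  assumes A: "linear A" and "reformulation (A, b, c) d"
  shows "coordinate_change (A, b, c) d"
  using assms(2) unfolding reformulation_def
proof (induction rule: rtranclp_induct)
  case base
  show ?case
    using reform_step_coordinate_change[OF reform_step.shift_rhs[of A b c 0] A]
    by (simp add: linear_0[OF A])
next
  case (step d d')
  obtain A1 b1 c1 A2 b2 c2 where d: "d = (A1, b1, c1)" "d' = (A2, b2, c2)"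
    by (metis prod_cases3)
  have "linear A1"
    using coordinate_change_linear[OF A] step.IH d(1) by simp
  then have "coordinate_change (A1, b1, c1) (A2, b2, c2)"
    using reform_step_coordinate_change step.hyps(2) d by simp
  then show ?case
    using coordinate_change_trans[OF A] step.IH d by simp
qed

lemma reformulation_trans:
  "reformulation d d' \<Longrightarrow> reformulation d' d'' \<Longrightarrow> reformulation d d''"
  unfolding reformulation_def by (rule rtranclp_trans)

lemma reform_step_reformulation: "reform_step d d' \<Longrightarrow> reformulation d d'"
  unfolding reformulation_def by (rule r_into_rtranclp)

text \<open>An isomorphism of the variables is a product of coordinate scalings, transpositions and elementary
  shears; a scaling replaces columns one at a time, a shear replaces one column and a transposition
  switches two. Factors of an invertible product are themselves invertible, so singular generators do
  not occur.\<close>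

lemma reformulation_variables:
  fixes M :: "real^'m \<Rightarrow> real^'m" and A :: "real^'m \<Rightarrow> real^'n^'n"
  assumes "linear M" and "inj M" and "linear A"
  shows "reformulation (A, b, c) (\<lambda>x. A (M x), b, adjoint M c)"
proof -
  define P where "P M \<longleftrightarrow> (inj M \<longrightarrow> (\<forall>(A :: real^'m \<Rightarrow> real^'n^'n) b c. linear A \<longrightarrow>
    reformulation (A, b, c) (\<lambda>x. A (M x), b, adjoint M c)))" for M :: "real^'m \<Rightarrow> real^'m"
  have replace: "P (replace_basis i l)" if "l $ i \<noteq> 0" for i l
    unfolding P_def
  proof (intro impI allI)
    fix A :: "real^'m \<Rightarrow> real^'n^'n" and b c
    assume "linear A"
    then show "reformulation (A, b, c)
        (\<lambda>x. A (replace_basis i l x), b, adjoint (replace_basis i l) c)"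
      using reform_step_reformulation[OF reform_step.replace_col[OF that, of A b c]]
      by (simp add: replace_col_eq)
  qed
  have comp: "P (f \<circ> g)" if fg: "linear f" "linear g" "P f" "P g" for f g
    unfolding P_def
  proof (intro impI allI)
    fix A :: "real^'m \<Rightarrow> real^'n^'n" and b c
    assume inj: "inj (f \<circ> g)" and A: "linear A"
    have "inj g"
      using inj by (rule inj_on_imageI2)
    moreover have "surj (f \<circ> g)"
      using linear_injective_imp_surjective[OF linear_compose[OF fg(2,1)] inj] by simp
    then have "surj f"
      by (auto simp: surj_def)
    then have "inj f"
      using linear_surjective_imp_injective[OF fg(1)] by simp
    moreover have "linear (\<lambda>x. A (f x))"
      using linear_compose[OF fg(1) A] by (simp add: o_def)
    ultimately have "reformulation (A, b, c) (\<lambda>x. A (f x), b, adjoint f c)"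
      "reformulation (\<lambda>x. A (f x), b, adjoint f c)
        (\<lambda>x. A (f (g x)), b, adjoint g (adjoint f c))"
      using fg(3,4) A unfolding P_def by blast+
    then show "reformulation (A, b, c) (\<lambda>x. A ((f \<circ> g) x), b, adjoint (f \<circ> g) c)"
      using reformulation_trans by (simp add: o_def adjoint_compose[OF fg(1,2)])
  qed
  have "P M"
    using assms(1)
  proof (rule induct_linear_elementary)
    show "P (f \<circ> g)" if "linear f" "linear g" "P f" "P g" for f g
      using comp[OF that] .
  next
    fix f :: "real^'m \<Rightarrow> real^'m" and i
    assume f: "linear f" "\<And>x. f x $ i = 0"
    have "\<not> inj f"
    proof
      assume "inj f"
      then have "surj f"
        using linear_injective_imp_surjective[OF f(1)] by simp
      then obtain x where "axis i 1 = f x"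
        by (rule surjE)
      then have "axis i 1 $ i = (0 :: real)"
        using f(2)[of x] by simp
      then show False by simp
    qed
    then show "P f"
      by (simp add: P_def)
  next
    fix d :: "'m \<Rightarrow> real"
    show "P (\<lambda>x. \<chi> i. d i * x $ i)"
    proof (cases "\<forall>i. d i \<noteq> 0")
      case False
      then obtain i where "d i = 0" by blast
      then have "(\<chi> j. d j * axis i 1 $ j) = (\<chi> j. d j * (0 :: real^'m) $ j)"
        by (auto simp: vec_eq_iff axis_def)
      then have "\<not> inj (\<lambda>x. \<chi> i. d i * x $ i)"
        by (metis axis_eq_0_iff injD zero_neq_one)
      then show ?thesis
        by (simp add: P_def)
    next
      case True
      define D where "D S x = (\<chi> i. (if i \<in> S then d i else 1) * x $ i)"
        for S :: "'m set" and x :: "real^'m"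
      have lin: "linear (D S)" for S
        by (auto intro!: linearI simp: D_def vec_eq_iff algebra_simps)
      have "P (D S)" if "finite S" for S
        using that
      proof (induction S rule: finite_induct)
        case empty
        have "D {} = (\<lambda>x. x)"
          by (auto simp: D_def vec_eq_iff)
        then show ?case
          by (auto simp: P_def adjoint_ident reformulation_def)
      next
        case (insert i S)
        have "D (insert i S) = D S \<circ> replace_basis i (d i *\<^sub>R axis i 1)"
          using insert.hyps
          by (auto simp: D_def replace_basis_def fun_eq_iff vec_eq_iff axis_def algebra_simps)
        moreover have "P (replace_basis i (d i *\<^sub>R axis i 1))"
          using True by (intro replace) simp
        ultimately show ?case
          using comp[OF lin linear_replace_basis insert.IH] by (simp only:)
      qed
      from this[of UNIV] show ?thesis
        by (simp add: D_def[abs_def])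
    qed
  next
    fix i j :: 'm
    assume ij: "i \<noteq> j"
    have "(\<lambda>x :: real^'m. \<chi> h. x $ Transposition.transpose i j h) = switch_basis i j"
      using ij by (auto simp: switch_basis_def fun_eq_iff vec_eq_iff axis_def transpose_def)
    moreover have "P (switch_basis i j)"
      unfolding P_def
    proof (intro impI allI)
      fix A :: "real^'m \<Rightarrow> real^'n^'n" and b c
      assume "linear A"
      then show "reformulation (A, b, c)
          (\<lambda>x. A (switch_basis i j x), b, adjoint (switch_basis i j) c)"
        using reform_step_reformulation[OF reform_step.switch_cols[OF ij, of A b c]]
        by (simp add: switch_cols_eq ij)
    qed
    ultimately show "P (\<lambda>x. \<chi> h. x $ Transposition.transpose i j h)"
      by simp
  next
    fix i j :: 'm
    assume ij: "i \<noteq> j"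
    have "(\<lambda>x :: real^'m. \<chi> h. if h = i then x $ i + x $ j else x $ h)
        = replace_basis j (axis j 1 + axis i 1)"
      using ij by (auto simp: replace_basis_def fun_eq_iff vec_eq_iff axis_def)
    moreover have "P (replace_basis j (axis j 1 + axis i 1))"
      using ij by (intro replace) (simp add: axis_def)
    ultimately show "P (\<lambda>x. \<chi> h. if h = i then x $ i + x $ j else x $ h)"
      by simp
  qed
  then show ?thesis
    using assms(2,3) by (simp add: P_def)
qed

lemma coordinate_change_reformulation:
  fixes A :: "real^'m \<Rightarrow> real^'n^'n"
  assumes A: "linear A" and M: "linear M" "inj M" and t: "invertible t"
  shows "reformulation (A, b, c) (\<lambda>x. congr t (A (M x)), congr t (b + A u), adjoint M c)"
proof -
  have "linear (\<lambda>x. A (M x))"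
    using linear_compose[OF M(1) A] by (simp add: o_def)
  then have "reform_step (\<lambda>x. A (M x), b + A u, adjoint M c)
      (\<lambda>x. congr t (A (M x)), congr t (b + A u), adjoint M c)"
    using reform_step.rotate[OF t, of "\<lambda>x. A (M x)" "b + A u" "adjoint M c"]
    by (simp add: rotate_eq congr_def)
  then show ?thesis
    using reform_step.shift_rhs[of A b c u] reformulation_variables[OF M A, of "b + A u" c]
    by (meson reform_step_reformulation reformulation_trans)
qed

lemma independent_extend_columns:
  fixes xs :: "(real^'m::{finite,linorder}) list"
  assumes "distinct xs" and "independent (set xs)"
  obtains M where "linear M" "inj M" "length xs \<le> CARD('m)"
    "\<forall>i<length xs. M (axis (ix i :: 'm) (1 :: real)) = xs ! i"
proof -
  define B where "B = extend_basis (set xs)"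
  have B: "set xs \<subseteq> B" "independent B" "span B = UNIV"
    using assms(2) by (simp_all add: B_def extend_basis_superset independent_extend_basis)
  then have card_B: "card B = CARD('m)"
    using dim_eq_card_independent[OF B(2)] by (metis DIM_cart DIM_real dim_UNIV dim_span mult.right_neutral)
  have fin: "finite B"
    using B(2) by (rule independent_imp_finite)
  obtain ys where ys: "set ys = B - set xs" "distinct ys"
    using finite_distinct_list[of "B - set xs"] fin by auto
  define zs where "zs = xs @ ys"
  have zs: "set zs = B" "distinct zs"
    using ys B(1) assms(1) by (auto simp: zs_def)
  then have len: "length zs = CARD('m)"
    using card_B distinct_card by metis
  define M :: "real^'m::{finite,linorder} \<Rightarrow> real^'m::{finite,linorder}"
    where "M x = (\<Sum>r<CARD('m). x $ ix r *\<^sub>R zs ! r)" for x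
  have lin: "linear M"
    by (intro linearI)
      (simp_all add: M_def scaleR_add_left sum.distrib scaleR_sum_right)
  have M_axis: "M (axis (ix i) 1) = zs ! i" if i: "i < CARD('m)" for i
  proof -
    have "(axis (ix i :: 'm) (1 :: real) $ ix r) *\<^sub>R zs ! r = (if r = i then zs ! i else 0)"
      if "r < CARD('m)" for r
    proof -
      have "(ix r :: 'm) = ix i \<longleftrightarrow> r = i"
        by (rule inj_on_eq_iff[OF inj_on_ix]) (use i that in auto)
      then show ?thesis
        by (auto simp: axis_def)
    qed
    then have "M (axis (ix i) 1) = (\<Sum>r<CARD('m). if r = i then zs ! i else 0)"
      unfolding M_def by (intro sum.cong) auto
    then show ?thesis
      using i by simp
  qed
  have "B \<subseteq> range M"
    using M_axis zs(1) len by (metis in_set_conv_nth rangeI subsetI)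
  then have "surj M"
    using span_minimal[OF _ linear_subspace_image[OF lin subspace_UNIV]] B(3) by blast
  then have "inj M"
    by (rule linear_surjective_imp_injective[OF lin]) simp
  moreover have "length xs \<le> CARD('m)"
    using len by (simp add: zs_def)
  moreover have "\<forall>i<length xs. M (axis (ix i) 1) = xs ! i"
    using M_axis len by (simp add: zs_def nth_append)
  ultimately show ?thesis
    using that lin by blast
qed

lemma linear_left_inverse:
  fixes A :: "real^'m \<Rightarrow> real^'n^'n"
  assumes "linear A" and "inj A"
  obtains g where "linear g" "\<forall>x. g (A x) = x"
  using linear_injective_left_inverse[OF assms] by (metis comp_apply id_apply)

text \<open>Independent elements of the range, pulled back to the variables, extend to a basis; the change of
  variables to this basis makes them the leading columns. Their congruence images are then the leading
  columns of the rotated data.\<close>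

lemma leading_columns_reformulation:
  fixes A :: "real^'m::{finite,linorder} \<Rightarrow> real^'n^'n"
  assumes A: "linear A" "inj A" and us: "distinct us" "independent (set us)" "set us \<subseteq> range A"
    and t: "invertible t"
  obtains A' c' where "reformulation (A, b, c) (A', congr t (b + A u), c')"
    "length us \<le> CARD('m)" "first_cols A' (length us) = map (congr t) us"
    "\<forall>i<length us. \<forall>x. us ! i = A x \<longrightarrow> c' $ ix i = c \<bullet> x"
proof -
  obtain g where g: "linear g" "\<forall>x. g (A x) = x"
    using linear_left_inverse[OF A] by blast
  have inj_g: "inj_on g (range A)"
    using g(2) by (intro inj_onI) auto
  have "subspace (range A)"
    using linear_subspace_image[OF A(1) subspace_UNIV] .
  then have "span (set us) \<subseteq> range A"
    using us(3) by (intro span_minimal)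
  then have indep: "independent (set (map g us))"
    using linear_independent_injective_image[OF g(1) us(2)] inj_g
    by (simp add: inj_on_subset)
  have dist: "distinct (map g us)"
    using us(1,3) inj_g by (auto simp: distinct_map intro: inj_on_subset)
  obtain M where M': "linear M" "inj M" "length (map g us) \<le> CARD('m)"
    "\<forall>i<length (map g us). M (axis (ix i :: 'm) (1 :: real)) = map g us ! i"
    using independent_extend_columns[OF dist indep] by blast
  then have M: "linear M" "inj M" "length us \<le> CARD('m)"
    "\<And>i. i < length us \<Longrightarrow> M (axis (ix i :: 'm) (1 :: real)) = g (us ! i)"
    by simp_all
  have Ag: "A (g v) = v" if "v \<in> set us" for v
    using that us(3) g(2) by auto
  have "first_cols (\<lambda>x. congr t (A (M x))) (length us) = map (congr t) us"
    using M(4) Ag by (intro nth_equalityI) (auto simp: first_cols_def cols_def)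
  moreover have "adjoint M c $ ix i = c \<bullet> x" if "i < length us" "us ! i = A x" for i x
  proof -
    have "adjoint M c $ ix i = axis (ix i) 1 \<bullet> adjoint M c"
      by (simp add: inner_axis')
    also have "\<dots> = x \<bullet> c"
      using that M(4) g(2) by (simp add: adjoint_works[OF M(1)])
    finally show ?thesis by (simp add: inner_commute)
  qed
  ultimately show ?thesis
    using that coordinate_change_reformulation[OF A(1) M(1,2) t] M(3) by blast
qed

section \<open>The four certificates\<close>

lemma psd_cone_scaleR: "s \<in> psd_cone \<Longrightarrow> 0 \<le> r \<Longrightarrow> r *\<^sub>R s \<in> psd_cone"
  by (simp add: psd_cone_def sym_mats_scaleR form_scaleR)

lemma psd_cone_sym: "s \<in> psd_cone \<Longrightarrow> s \<in> sym_mats"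
  by (simp add: psd_cone_def)

lemma nonneg_if_not_normalized:
  fixes h :: "real^'n^'n"
  assumes "\<And>s. s \<in> psd_cone \<Longrightarrow> \<forall>u\<in>U. s \<bullet> u = 0 \<Longrightarrow> s \<bullet> h = -1 \<Longrightarrow> False"
  shows "\<forall>s\<in>psd_cone. (\<forall>u\<in>U. s \<bullet> u = 0) \<longrightarrow> 0 \<le> s \<bullet> h"
proof (intro ballI impI)
  fix s :: "real^'n^'n"
  assume s: "s \<in> psd_cone" "\<forall>u\<in>U. s \<bullet> u = 0"
  show "0 \<le> s \<bullet> h"
  proof (rule ccontr)
    assume neg: "\<not> 0 \<le> s \<bullet> h"
    define r where "r = - 1 / (s \<bullet> h)"
    have r: "0 \<le> r" "r * (s \<bullet> h) = -1"
      using neg by (auto simp: r_def field_simps)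
    show False
      using assms[of "r *\<^sub>R s"] s r by (simp add: psd_cone_scaleR)
  qed
qed

text \<open>The adjoint is defined on all matrices, whereas certificates must be symmetric. Passing to the
  symmetric part changes no inner product with a symmetric matrix, in particular none with the range
  of \<open>A\<close>.\<close>

lemma adjoint_symmetrize:
  fixes A :: "real^'m \<Rightarrow> real^'n^'n"
  assumes A: "linear A" "range A \<subseteq> sym_mats"
  obtains y' where "y' \<in> sym_mats" "adjoint A y' = adjoint A y"
    "\<forall>s\<in>sym_mats. s \<bullet> y' = s \<bullet> y"
proof -
  define y' where "y' = (1 / 2) *\<^sub>R (y + transpose y)"
  have sym: "y' \<in> sym_mats"
    by (simp add: y'_def sym_mats_def transpose_def vec_eq_iff)
  have inner: "s \<bullet> y' = s \<bullet> y" if "s \<in> sym_mats" for s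
    using that inner_transpose_left[of y s]
    by (simp add: y'_def inner_add_right sym_mats_def inner_commute)
  have "adjoint A y' = adjoint A y"
  proof (rule adjoint_eqI[OF A(1)])
    fix x
    have "A x \<bullet> y' = A x \<bullet> y"
      using A(2) by (intro inner) auto
    then show "A x \<bullet> y' = x \<bullet> adjoint A y"
      by (simp add: adjoint_works[OF A(1)])
  qed
  with sym inner show ?thesis
    using that by blast
qed

lemma in_range_if_orthogonal:
  fixes A :: "real^'m \<Rightarrow> real^'n^'n"
  assumes A: "linear A" "range A \<subseteq> sym_mats" and s: "s \<in> sym_mats"
    and orth: "\<And>y. y \<in> sym_mats \<Longrightarrow> adjoint A y = 0 \<Longrightarrow> s \<bullet> y = 0"
  shows "\<exists>x. s = A x"
proof -
  have "y \<bullet> s = 0" if y: "y \<in> orthogonal_comp (range A)" for y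
  proof -
    have "adjoint A y = 0"
      using y by (intro adjoint_eqI[OF A(1)]) (auto simp: orthogonal_comp_def orthogonal_def)
    moreover obtain y' where "y' \<in> sym_mats" "adjoint A y' = adjoint A y"
      "\<forall>s\<in>sym_mats. s \<bullet> y' = s \<bullet> y"
      using adjoint_symmetrize[OF A] by blast
    ultimately show ?thesis
      using orth[of y'] s by (simp add: inner_commute)
  qed
  then have "s \<in> orthogonal_comp (orthogonal_comp (range A))"
    by (subst orthogonal_comp_def) (simp add: orthogonal_def)
  then show ?thesis
    using orthogonal_comp_self[OF linear_subspace_image[OF A(1) subspace_UNIV]] by auto
qed

text \<open>Here \<open>U\<close> consists of the \<open>A x\<close> with \<open>c \<bullet> x = 0\<close>, and \<open>h = A x\<^sub>0\<close> with \<open>c \<bullet> x\<^sub>0 = -1\<close>. A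
  normalized semidefinite \<open>s\<close> orthogonal to \<open>U\<close> has \<open>A x \<bullet> s = c \<bullet> x\<close> on \<open>U\<close> and at \<open>h\<close>, hence everywhere,
  so it would solve the system. The last member is independent of the others because \<open>c\<close> is nonzero on
  it.\<close>

lemma D_certificate_exists:
  fixes A :: "real^'m::{finite,linorder} \<Rightarrow> real^'n::{finite,linorder}^'n::{finite,linorder}"
  assumes A: "linear A" "inj A" "range A \<subseteq> sym_mats" and inf: "\<not> D_feasible A c"
  shows "\<exists>A' b' c' k. reformulation (A, b, c) (A', b', c') \<and> D_infeasible_cert A' c' k \<and>
    k \<le> CARD('n) - 1 \<and> pre_strict_FR psd_cone (first_cols A' (k + 1))"
proof -
  have "c \<noteq> 0"
  proof
    assume "c = 0"
    then have "adjoint A 0 = c"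
      by (simp add: linear_0[OF adjoint_linear[OF A(1)]])
    moreover have "(0 :: real^'n::{finite,linorder}^'n::{finite,linorder}) \<preceq> 0"
      by (simp add: psd_le_def psd_cone_def sym_mats_def transpose_def vec_eq_iff)
    ultimately show False
      using inf unfolding D_feasible_def by blast
  qed
  define x0 where "x0 = (- 1 / (c \<bullet> c)) *\<^sub>R c"
  have x0: "c \<bullet> x0 = -1"
    using \<open>c \<noteq> 0\<close> by (simp add: x0_def)
  define U where "U = A ` {x. c \<bullet> x = 0}"
  have "subspace {x. c \<bullet> x = 0}"
    by (simp add: subspace_hyperplane)
  then have U: "subspace U"
    unfolding U_def by (rule linear_subspace_image[OF A(1)])
  have U_sym: "U \<subseteq> sym_mats" "A x0 \<in> sym_mats"
    using A(3) by (auto simp: U_def)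
  have nonneg: "\<forall>s\<in>psd_cone. (\<forall>u\<in>U. s \<bullet> u = 0) \<longrightarrow> 0 \<le> s \<bullet> A x0"
  proof (rule nonneg_if_not_normalized)
    fix s :: "real^'n::{finite,linorder}^'n::{finite,linorder}"
    assume s: "s \<in> psd_cone" "\<forall>u\<in>U. s \<bullet> u = 0" "s \<bullet> A x0 = -1"
    have "adjoint A s = c"
    proof (rule adjoint_eqI[OF A(1)])
      fix x
      have "c \<bullet> (x + (c \<bullet> x) *\<^sub>R x0) = 0"
        using x0 by (simp add: inner_add_right)
      then have "s \<bullet> A (x + (c \<bullet> x) *\<^sub>R x0) = 0"
        using s(2) by (auto simp: U_def)
      then show "A x \<bullet> s = x \<bullet> c"
        using s(3)
        by (simp add: linear_add[OF A(1)] linear_scale[OF A(1)] inner_add_right inner_commute)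
    qed
    moreover have "0 \<preceq> s"
      using s(1) by (simp add: psd_le_def)
    ultimately show False
      using inf by (auto simp: D_feasible_def)
  qed
  obtain us u t where us: "set us \<subseteq> U" "u \<in> U" "distinct us" "independent (set us)"
    "length us \<le> CARD('n) - 1" "invertible t"
    "map (congr t) (us @ [A x0 + u]) \<in> REGFR (length us + 1)"
    "pre_strict_FR psd_cone (map (congr t) (us @ [A x0 + u]))"
    by (rule regularized_certificate[OF U U_sym nonneg])
  obtain x1 where x1: "u = A x1" "c \<bullet> x1 = 0"
    using us(2) by (auto simp: U_def)
  have last: "A x0 + u = A (x0 + x1)" "c \<bullet> (x0 + x1) = -1"
    using x0 x1 by (auto simp: linear_add[OF A(1)] inner_add_right)
  have notU: "A x0 + u \<notin> U"
  proof
    assume "A x0 + u \<in> U"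
    then obtain x where "A x0 + u = A x" "c \<bullet> x = 0"
      by (auto simp: U_def)
    then have "x = x0 + x1"
      using last(1) injD[OF A(2)] by metis
    then show False
      using \<open>c \<bullet> x = 0\<close> last(2) by simp
  qed
  have "span (set us) \<subseteq> U"
    using us(1) U by (intro span_minimal)
  then have vs: "distinct (us @ [A x0 + u])" "independent (set (us @ [A x0 + u]))"
    "set (us @ [A x0 + u]) \<subseteq> range A"
    using us(1,3,4) last(1) notU by (auto simp: independent_insert U_def)
  obtain A' c' where A': "reformulation (A, b, c) (A', congr t (b + A 0), c')"
    "length (us @ [A x0 + u]) \<le> CARD('m)"
    "first_cols A' (length (us @ [A x0 + u])) = map (congr t) (us @ [A x0 + u])"
    "\<forall>i<length (us @ [A x0 + u]). \<forall>x. (us @ [A x0 + u]) ! i = A x \<longrightarrow> c' $ ix i = c \<bullet> x"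
    using leading_columns_reformulation[OF A(1,2) vs us(6), where b = b and c = c and u = 0] by blast
  have "c' $ ix i = 0" if i: "i < length us" for i
  proof -
    have "us ! i \<in> U"
      using i us(1) nth_mem by blast
    then obtain x where "us ! i = A x" "c \<bullet> x = 0"
      by (auto simp: U_def)
    then show ?thesis
      using A'(4)[rule_format, of i x] i by (simp add: nth_append)
  qed
  moreover have "c' $ ix (length us) = -1"
    using A'(4)[rule_format, of "length us" "x0 + x1"] last by simp
  ultimately have "D_infeasible_cert A' c' (length us)"
    using A'(2,3) us(7) by (simp add: D_infeasible_cert_def)
  then show ?thesis
    using A'(1,3) us(5,8) by (intro exI[of _ A'] exI conjI) auto
qed

text \<open>Here \<open>U\<close> is the range of \<open>A\<close> and \<open>h = b\<close>, and a normalized semidefinite \<open>s\<close> would be a solution of the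
  system that defines strong infeasibility. The correction \<open>u \<in> U\<close> becomes the shift of \<open>b\<close>.\<close>

lemma P_not_strong_certificate_exists:
  fixes A :: "real^'m::{finite,linorder} \<Rightarrow> real^'n::{finite,linorder}^'n::{finite,linorder}"
  assumes A: "linear A" "inj A" "range A \<subseteq> sym_mats" and b: "b \<in> sym_mats"
    and ninf: "\<not> P_strongly_infeasible A b"
  shows "\<exists>A' b' c' l. reformulation (A, b, c) (A', b', c') \<and>
    P_not_strongly_infeasible_cert A' b' l \<and> l \<le> CARD('n) - 1 \<and>
    pre_strict_FR psd_cone (first_cols A' l @ [b'])"
proof -
  have U: "subspace (range A)"
    using linear_subspace_image[OF A(1) subspace_UNIV] .
  have nonneg: "\<forall>s\<in>psd_cone. (\<forall>u\<in>range A. s \<bullet> u = 0) \<longrightarrow> 0 \<le> s \<bullet> b"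
  proof (rule nonneg_if_not_normalized)
    fix s :: "real^'n::{finite,linorder}^'n::{finite,linorder}"
    assume s: "s \<in> psd_cone" "\<forall>u\<in>range A. s \<bullet> u = 0" "s \<bullet> b = -1"
    have "adjoint A s = 0"
      using s(2) by (intro adjoint_eqI[OF A(1)]) (simp add: inner_commute)
    then show False
      using ninf s(1,3) by (auto simp: P_strongly_infeasible_def psd_le_def inner_commute)
  qed
  obtain us u t where us: "set us \<subseteq> range A" "u \<in> range A" "distinct us"
    "independent (set us)" "length us \<le> CARD('n) - 1" "invertible t"
    "map (congr t) (us @ [b + u]) \<in> REGFR (length us + 1)"
    "pre_strict_FR psd_cone (map (congr t) (us @ [b + u]))"
    by (rule regularized_certificate[OF U A(3) b nonneg])
  obtain x where x: "u = A x"
    using us(2) by blast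
  obtain A' c' where A': "reformulation (A, b, c) (A', congr t (b + A x), c')"
    "length us \<le> CARD('m)" "first_cols A' (length us) = map (congr t) us"
    "\<forall>i<length us. \<forall>x. us ! i = A x \<longrightarrow> c' $ ix i = c \<bullet> x"
    using leading_columns_reformulation[OF A(1,2) us(3,4,1,6), where b = b and c = c and u = x] by blast
  have "P_not_strongly_infeasible_cert A' (congr t (b + A x)) (length us)"
    using A'(2,3) us(7) x by (simp add: P_not_strongly_infeasible_cert_def)
  then show ?thesis
    using A' us(5,8) x by (intro exI[of _ A'] exI conjI) auto
qed

text \<open>When the certificate consists of dual matrices, these are regularized by \<open>t\<close>, and the data must be
  rotated by the inverse transpose of \<open>t\<close> to preserve all inner products.\<close>

lemma rotation_reformulation:
  fixes A :: "real^'m \<Rightarrow> real^'n^'n"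
  assumes A: "linear A" and t: "invertible t"
  obtains A' b' where "reformulation (A, b, c) (A', b', c)"
    "\<forall>y. adjoint A' (congr t y) = adjoint A y" "\<forall>y. b' \<bullet> congr t y = b \<bullet> y"
proof -
  obtain t' where t': "invertible t'" "\<forall>a y. congr t' a \<bullet> congr t y = a \<bullet> y"
    using congruence_pairing[OF t] by blast
  have "reformulation (A, b, c) (\<lambda>x. congr t' (A x), congr t' (b + A 0), adjoint (\<lambda>x. x) c)"
    using coordinate_change_reformulation[OF A linear_ident _ t'(1)] by simp
  then have "reformulation (A, b, c) (\<lambda>x. congr t' (A x), congr t' b, c)"
    by (simp add: adjoint_ident linear_0[OF A])
  moreover have "adjoint (\<lambda>x. congr t' (A x)) (congr t y) = adjoint A y" for y
    using linear_compose[OF A linear_congr[of t']]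
    by (intro adjoint_eqI) (simp_all add: o_def t'(2) adjoint_works[OF A])
  ultimately show ?thesis
    using that t'(2) by blast
qed

lemma subspace_adjoint_kernel:
  fixes A :: "real^'m \<Rightarrow> real^'n^'n"
  assumes "linear A"
  shows "subspace {y \<in> sym_mats. adjoint A y = 0}"
    and "subspace {y \<in> sym_mats. adjoint A y = 0 \<and> b \<bullet> y = 0}"
  using subspace_sym_mats adjoint_linear[OF assms]
  by (auto simp: subspace_def linear_0 linear_add linear_scale inner_add_right)

text \<open>Here \<open>U\<close> is the kernel of the adjoint and \<open>h\<close> is a symmetric solution of \<open>A\<^sup>* h = c\<close>, which exists
  because \<open>A\<close> is injective. A symmetric matrix orthogonal to \<open>U\<close> has the form \<open>A x\<close>, and its inner product with
  \<open>h\<close> is \<open>c \<bullet> x\<close>.\<close>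

lemma D_not_strong_certificate_exists:
  fixes A :: "real^'m \<Rightarrow> real^'n::{finite,linorder}^'n::{finite,linorder}"
  assumes A: "linear A" "inj A" "range A \<subseteq> sym_mats" and ninf: "\<not> D_strongly_infeasible A c"
  shows "\<exists>A' b' c' l ys. reformulation (A, b, c) (A', b', c') \<and>
    D_not_strongly_infeasible_cert A' c' l ys \<and> l \<le> CARD('n) - 1 \<and> pre_strict_FR psd_cone ys"
proof -
  define U where "U = {y \<in> sym_mats. adjoint A y = 0}"
  have U: "subspace U" "U \<subseteq> sym_mats"
    using subspace_adjoint_kernel[OF A(1)] by (auto simp: U_def)
  obtain h where h: "h \<in> sym_mats" "adjoint A h = c"
  proof -
    obtain y where "c = adjoint A y"
      using A(2) surj_adjoint_iff_inj[OF A(1)] by (auto simp: surj_def)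
    then show ?thesis
      using adjoint_symmetrize[OF A(1,3), of y] that by auto
  qed
  have nonneg: "\<forall>s\<in>psd_cone. (\<forall>u\<in>U. s \<bullet> u = 0) \<longrightarrow> 0 \<le> s \<bullet> h"
  proof (rule nonneg_if_not_normalized)
    fix s :: "real^'n::{finite,linorder}^'n::{finite,linorder}"
    assume s: "s \<in> psd_cone" "\<forall>u\<in>U. s \<bullet> u = 0" "s \<bullet> h = -1"
    obtain x where x: "s = A x"
      using in_range_if_orthogonal[OF A(1,3) psd_cone_sym[OF s(1)]] s(2) by (auto simp: U_def)
    have "x \<bullet> c = -1"
      using s(3) adjoint_works[OF A(1), of x h] x h(2) by simp
    then show False
      using ninf s(1) x by (auto simp: D_strongly_infeasible_def psd_le_def inner_commute)
  qed
  obtain us u t where us: "set us \<subseteq> U" "u \<in> U" "distinct us" "independent (set us)"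
    "length us \<le> CARD('n) - 1" "invertible t"
    "map (congr t) (us @ [h + u]) \<in> REGFR (length us + 1)"
    "pre_strict_FR psd_cone (map (congr t) (us @ [h + u]))"
    by (rule regularized_certificate[OF U h(1) nonneg])
  obtain A' b' where A': "reformulation (A, b, c) (A', b', c)"
    "\<forall>y. adjoint A' (congr t y) = adjoint A y" "\<forall>y. b' \<bullet> congr t y = b \<bullet> y"
    using rotation_reformulation[OF A(1) us(6), where b = b and c = c] by blast
  have "adjoint A (us ! i) = 0" if "i < length us" for i
  proof -
    have "us ! i \<in> U"
      using that us(1) nth_mem by blast
    then show ?thesis by (simp add: U_def)
  qed
  moreover have "adjoint A (h + u) = c"
    using us(2) h(2) by (simp add: U_def linear_add[OF adjoint_linear[OF A(1)]])
  ultimately have "D_not_strongly_infeasible_cert A' c (length us) (map (congr t) (us @ [h + u]))"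
    using us(7) A'(2) by (simp add: D_not_strongly_infeasible_cert_def nth_append)
  then show ?thesis
    using A'(1) us(5,8) by blast
qed

text \<open>Here \<open>U\<close> consists of the elements of the kernel of the adjoint that are orthogonal to \<open>b\<close>, and \<open>h\<close> is
  an element of the kernel with \<open>b \<bullet> h = -1\<close>. A normalized semidefinite \<open>s\<close> orthogonal to \<open>U\<close> has the
  same inner products with the kernel as \<open>b\<close>, so \<open>b - s\<close> lies in the range of \<open>A\<close> and \<open>s\<close> is the slack
  of a feasible point.\<close>

lemma P_certificate_exists:
  fixes A :: "real^'m \<Rightarrow> real^'n::{finite,linorder}^'n::{finite,linorder}"
  assumes A: "linear A" "range A \<subseteq> sym_mats" and b: "b \<in> sym_mats" and inf: "\<not> P_feasible A b"
  shows "\<exists>A' b' c' k ys. reformulation (A, b, c) (A', b', c') \<and> P_infeasible_cert A' b' k ys \<and>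
    k \<le> CARD('n) - 1 \<and> pre_strict_FR psd_cone ys"
proof -
  define U where "U = {y \<in> sym_mats. adjoint A y = 0 \<and> b \<bullet> y = 0}"
  have U: "subspace U" "U \<subseteq> sym_mats"
    using subspace_adjoint_kernel(2)[OF A(1)] by (auto simp: U_def)
  have feas: False if "b - A x \<in> psd_cone" for x
    using that inf by (auto simp: P_feasible_def psd_le_def)
  have "\<exists>y\<in>sym_mats. adjoint A y = 0 \<and> b \<bullet> y \<noteq> 0"
  proof (rule ccontr)
    assume "\<not> ?thesis"
    then obtain x where "b = A x"
      using in_range_if_orthogonal[OF A b] by blast
    then have "b - A x = 0" by simp
    then have "b - A x \<in> psd_cone"
      by (simp only:) (simp add: psd_cone_def sym_mats_def transpose_def vec_eq_iff)
    then show False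
      by (rule feas)
  qed
  then obtain y0 where y0: "y0 \<in> sym_mats" "adjoint A y0 = 0" "b \<bullet> y0 \<noteq> 0" by blast
  define h where "h = (- 1 / (b \<bullet> y0)) *\<^sub>R y0"
  have h: "h \<in> sym_mats" "adjoint A h = 0" "b \<bullet> h = -1"
    unfolding h_def using y0 sym_mats_scaleR linear_scale[OF adjoint_linear[OF A(1)], of _ y0]
    by (simp_all del: scaleR_minus_left)
  have nonneg: "\<forall>s\<in>psd_cone. (\<forall>u\<in>U. s \<bullet> u = 0) \<longrightarrow> 0 \<le> s \<bullet> h"
  proof (rule nonneg_if_not_normalized)
    fix s :: "real^'n::{finite,linorder}^'n::{finite,linorder}"
    assume s: "s \<in> psd_cone" "\<forall>u\<in>U. s \<bullet> u = 0" "s \<bullet> h = -1"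
    have "b - s \<in> sym_mats"
      using subspace_diff[OF subspace_sym_mats b psd_cone_sym[OF s(1)]] .
    moreover have "(b - s) \<bullet> y = 0" if y: "y \<in> sym_mats" "adjoint A y = 0" for y
    proof -
      have "y + (b \<bullet> y) *\<^sub>R h \<in> U"
        using y h adjoint_linear[OF A(1)]
        by (simp add: U_def sym_mats_add sym_mats_scaleR linear_add linear_scale inner_add_right)
      then have "s \<bullet> (y + (b \<bullet> y) *\<^sub>R h) = 0"
        using s(2) by blast
      then show ?thesis
        using s(3) by (simp add: inner_add_right inner_diff_left)
    qed
    ultimately obtain x where "b - s = A x"
      using in_range_if_orthogonal[OF A] by blast
    then have "b - A x = s" by (simp add: algebra_simps)
    then show False
      using feas[of x] s(1) by simp
  qed
  obtain us u t where us: "set us \<subseteq> U" "u \<in> U" "distinct us" "independent (set us)"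
    "length us \<le> CARD('n) - 1" "invertible t"
    "map (congr t) (us @ [h + u]) \<in> REGFR (length us + 1)"
    "pre_strict_FR psd_cone (map (congr t) (us @ [h + u]))"
    by (rule regularized_certificate[OF U h(1) nonneg])
  obtain A' b' where A': "reformulation (A, b, c) (A', b', c)"
    "\<forall>y. adjoint A' (congr t y) = adjoint A y" "\<forall>y. b' \<bullet> congr t y = b \<bullet> y"
    using rotation_reformulation[OF A(1) us(6), where b = b and c = c] by blast
  have "us ! i \<in> U" if "i < length us" for i
    using that us(1) nth_mem by blast
  moreover have "adjoint A (h + u) = 0" "b \<bullet> (h + u) = -1"
    using us(2) h by (auto simp: U_def linear_add[OF adjoint_linear[OF A(1)]] inner_add_right)
  ultimately have "P_infeasible_cert A' b' (length us) (map (congr t) (us @ [h + u]))"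
    using us(7) A'(2,3) by (simp add: P_infeasible_cert_def nth_append U_def)
  then show ?thesis
    using A'(1) us(5,8) by blast
qed

text \<open>Solutions move along a change of coordinates: \<open>x\<close> through the inverse of \<open>M\<close>, and \<open>y\<close> through the
  congruence dual to \<open>t\<close>.\<close>

lemma D_feasible_coordinate_change:
  assumes A: "linear A" and cc: "coordinate_change (A, b, c) (A', b', c')" and "D_feasible A c"
  shows "D_feasible A' c'"
proof -
  obtain y where y: "adjoint A y = c" "y \<in> psd_cone"
    using assms(3) by (auto simp: D_feasible_def psd_le_def)
  obtain M u t where 1: "linear M" "inj M" "invertible t" "A' = (\<lambda>x. congr t (A (M x)))"
    "b' = congr t (b + A u)" "c' = adjoint M c"
    using cc by (rule coordinate_changeE)
  obtain t' where "invertible t'" and t': "\<forall>a y. congr t' a \<bullet> congr t y = a \<bullet> y"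
    by (rule congruence_pairing[OF 1(3)])
  have "adjoint A' (congr t' y) = c'"
  proof (rule adjoint_eqI[OF coordinate_change_linear[OF A cc]])
    fix x
    have "A' x \<bullet> congr t' y = A (M x) \<bullet> y"
      using t'[rule_format, of y "A (M x)"] by (simp add: 1 inner_commute)
    then show "A' x \<bullet> congr t' y = x \<bullet> c'"
      by (simp add: 1(6) adjoint_works[OF 1(1)] adjoint_works[OF A, symmetric] flip: y(1))
  qed
  then show ?thesis
    using congr_psd[OF y(2)] by (auto simp: D_feasible_def psd_le_def)
qed

lemma P_strongly_infeasible_coordinate_change:
  assumes A: "linear A" and cc: "coordinate_change (A, b, c) (A', b', c')"
    and "P_strongly_infeasible A b"
  shows "P_strongly_infeasible A' b'"
proof -
  obtain y where y: "adjoint A y = 0" "b \<bullet> y = -1" "y \<in> psd_cone"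
    using assms(3) by (auto simp: P_strongly_infeasible_def psd_le_def)
  have Ay: "A x \<bullet> y = 0" for x
    using adjoint_works[OF A, of x y] y(1) by simp
  obtain M u t where 1: "linear M" "inj M" "invertible t" "A' = (\<lambda>x. congr t (A (M x)))"
    "b' = congr t (b + A u)" "c' = adjoint M c"
    using cc by (rule coordinate_changeE)
  obtain t' where "invertible t'" and t': "\<forall>a y. congr t' a \<bullet> congr t y = a \<bullet> y"
    by (rule congruence_pairing[OF 1(3)])
  have pair: "congr t a \<bullet> congr t' y = a \<bullet> y" for a
    using t'[rule_format, of y a] by (simp add: inner_commute)
  have "adjoint A' (congr t' y) = 0"
    by (rule adjoint_eqI[OF coordinate_change_linear[OF A cc]]) (simp add: 1(4) pair Ay)
  moreover have "b' \<bullet> congr t' y = -1"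
    by (simp add: 1(5) pair inner_add_left y(2) Ay)
  ultimately show ?thesis
    using congr_psd[OF y(3)] by (auto simp: P_strongly_infeasible_def psd_le_def)
qed

lemma D_strongly_infeasible_coordinate_change:
  fixes A :: "real^'m \<Rightarrow> real^'n^'n"
  assumes cc: "coordinate_change (A, b, c) (A', b', c')" and "D_strongly_infeasible A c"
  shows "D_strongly_infeasible A' c'"
proof -
  obtain x where x: "A x \<in> psd_cone" "c \<bullet> x = -1"
    using assms(2) by (auto simp: D_strongly_infeasible_def psd_le_def)
  obtain M u t where 1: "linear M" "inj M" "invertible t" "A' = (\<lambda>x. congr t (A (M x)))"
    "b' = congr t (b + A u)" "c' = adjoint M c"
    using cc by (rule coordinate_changeE)
  obtain x' where x': "x = M x'"
    using linear_injective_imp_surjective[OF 1(1,2)] by (auto simp: surj_def)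
  have "x' \<bullet> c' = -1"
    using x(2) by (simp add: 1(6) adjoint_works[OF 1(1)] x' inner_commute)
  then show ?thesis
    using congr_psd[OF x(1), of t] x'
    by (auto simp: D_strongly_infeasible_def psd_le_def 1(4) inner_commute)
qed

lemma P_feasible_coordinate_change:
  fixes A :: "real^'m \<Rightarrow> real^'n^'n"
  assumes A: "linear A" and cc: "coordinate_change (A, b, c) (A', b', c')" and "P_feasible A b"
  shows "P_feasible A' b'"
proof -
  obtain x where x: "b - A x \<in> psd_cone"
    using assms(3) by (auto simp: P_feasible_def psd_le_def)
  obtain M u t where 1: "linear M" "inj M" "invertible t" "A' = (\<lambda>x. congr t (A (M x)))"
    "b' = congr t (b + A u)" "c' = adjoint M c"
    using cc by (rule coordinate_changeE)
  obtain x' where x': "x + u = M x'"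
    using linear_injective_imp_surjective[OF 1(1,2)] by (auto simp: surj_def)
  have "b' - A' x' = congr t (b - A x)"
    by (simp add: 1 linear_diff[OF linear_congr] linear_add[OF linear_congr]
        linear_add[OF A] flip: x')
  then show ?thesis
    using congr_psd[OF x, of t] unfolding P_feasible_def psd_le_def by metis
qed

lemma D_infeasible_cert_sound:
  assumes A: "linear A" and cert: "D_infeasible_cert A c k"
  shows "\<not> D_feasible A c"
proof
  assume "D_feasible A c"
  then obtain y where y: "adjoint A y = c" "y \<in> psd_cone"
    by (auto simp: D_feasible_def psd_le_def)
  have col: "y \<bullet> cols A i = c $ i" for i
    using adjoint_works[OF A, of "axis i 1" y] y(1)
    by (simp add: cols_def inner_axis inner_axis' inner_commute)
  have "first_cols A k @ [cols A (ix k)] \<in> REGFR (k + 1)"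
    using cert by (simp add: D_infeasible_cert_def first_cols_def)
  moreover have "\<forall>u\<in>set (first_cols A k). y \<bullet> u = 0"
    using cert by (auto simp: first_cols_def D_infeasible_cert_def col)
  ultimately have "0 \<le> y \<bullet> cols A (ix k)"
    using REGFR_sound y(2) by blast
  then show False
    using cert by (simp add: col D_infeasible_cert_def)
qed

lemma list_snoc_nth:
  assumes "length ys = k + 1"
  shows "ys = take k ys @ [ys ! k]"
  using assms take_Suc_conv_app_nth[of k ys] by simp

lemma D_not_strongly_infeasible_cert_sound:
  assumes A: "linear A" and cert: "D_not_strongly_infeasible_cert A c l ys"
  shows "\<not> D_strongly_infeasible A c"
proof
  assume "D_strongly_infeasible A c"
  then obtain x where x: "A x \<in> psd_cone" "c \<bullet> x = -1"
    by (auto simp: D_strongly_infeasible_def psd_le_def)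
  have ys: "ys \<in> REGFR (l + 1)" "length ys = l + 1"
    using cert by (auto simp: D_not_strongly_infeasible_cert_def REGFR_def)
  have "A x \<bullet> ys ! i = 0" if "i < l" for i
    using cert that by (simp add: D_not_strongly_infeasible_cert_def flip: adjoint_works[OF A])
  then have "\<forall>u\<in>set (take l ys). A x \<bullet> u = 0"
    using ys(2) by (auto simp: in_set_conv_nth)
  then have "0 \<le> A x \<bullet> ys ! l"
    using REGFR_sound[of "take l ys" "ys ! l"] ys(1) x(1) list_snoc_nth[OF ys(2)] by metis
  then show False
    using x(2) cert
    by (simp add: D_not_strongly_infeasible_cert_def inner_commute flip: adjoint_works[OF A])
qed

lemma P_infeasible_cert_sound:
  assumes A: "linear A" and cert: "P_infeasible_cert A b k ys"
  shows "\<not> P_feasible A b"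
proof
  assume "P_feasible A b"
  then obtain x where x: "b - A x \<in> psd_cone"
    by (auto simp: P_feasible_def psd_le_def)
  have ys: "ys \<in> REGFR (k + 1)" "length ys = k + 1"
    using cert by (auto simp: P_infeasible_cert_def REGFR_def)
  have "(b - A x) \<bullet> ys ! i = 0" if "i < k" for i
    using cert that
    by (simp add: P_infeasible_cert_def inner_diff_left flip: adjoint_works[OF A])
  then have "\<forall>u\<in>set (take k ys). (b - A x) \<bullet> u = 0"
    using ys(2) by (auto simp: in_set_conv_nth)
  then have "0 \<le> (b - A x) \<bullet> ys ! k"
    using REGFR_sound[of "take k ys" "ys ! k"] ys(1) x list_snoc_nth[OF ys(2)] by metis
  then show False
    using cert by (simp add: P_infeasible_cert_def inner_diff_left flip: adjoint_works[OF A])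
qed

lemma P_not_strongly_infeasible_cert_sound:
  assumes A: "linear A" and cert: "P_not_strongly_infeasible_cert A b l"
  shows "\<not> P_strongly_infeasible A b"
proof
  assume "P_strongly_infeasible A b"
  then obtain y where y: "adjoint A y = 0" "b \<bullet> y = -1" "y \<in> psd_cone"
    by (auto simp: P_strongly_infeasible_def psd_le_def)
  have "A x \<bullet> y = 0" for x
    using adjoint_works[OF A, of x y] y(1) by simp
  then have "\<forall>u\<in>set (first_cols A l). y \<bullet> u = 0"
    by (auto simp: first_cols_def cols_def inner_commute)
  then have "0 \<le> y \<bullet> b"
    using cert REGFR_sound[OF _ y(3)] unfolding P_not_strongly_infeasible_cert_def by blast
  then show False
    using y(2) by (simp add: inner_commute)
qed

theorem theorem5:
  fixes A :: "real^'m::{finite,linorder} \<Rightarrow> real^'n::{finite,linorder}^'n::{finite,linorder}"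
    and b :: "real^'n::{finite,linorder}^'n::{finite,linorder}"
    and c :: "real^'m::{finite,linorder}"
  assumes "linear A" and "inj A" and "range A \<subseteq> sym_mats" and "b \<in> sym_mats"
  shows
    "(\<not> D_feasible A c \<longleftrightarrow>
       (\<exists>A' b' c' k. reformulation (A, b, c) (A', b', c') \<and> D_infeasible_cert A' c' k)) \<and>
     (\<not> D_feasible A c \<longrightarrow>
       (\<exists>A' b' c' k. reformulation (A, b, c) (A', b', c') \<and> D_infeasible_cert A' c' k \<and>
          k \<le> CARD('n) - 1 \<and> pre_strict_FR psd_cone (first_cols A' (k + 1)))) \<and>
     (\<not> D_strongly_infeasible A c \<longleftrightarrow>
       (\<exists>A' b' c' l ys. reformulation (A, b, c) (A', b', c') \<and>
          D_not_strongly_infeasible_cert A' c' l ys)) \<and>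
     (\<not> D_strongly_infeasible A c \<longrightarrow>
       (\<exists>A' b' c' l ys. reformulation (A, b, c) (A', b', c') \<and>
          D_not_strongly_infeasible_cert A' c' l ys \<and>
          l \<le> CARD('n) - 1 \<and> pre_strict_FR psd_cone ys)) \<and>
     (\<not> P_feasible A b \<longleftrightarrow>
       (\<exists>A' b' c' k ys. reformulation (A, b, c) (A', b', c') \<and> P_infeasible_cert A' b' k ys)) \<and>
     (\<not> P_feasible A b \<longrightarrow>
       (\<exists>A' b' c' k ys. reformulation (A, b, c) (A', b', c') \<and> P_infeasible_cert A' b' k ys \<and>
          k \<le> CARD('n) - 1 \<and> pre_strict_FR psd_cone ys)) \<and>
     (\<not> P_strongly_infeasible A b \<longleftrightarrow>
       (\<exists>A' b' c' l. reformulation (A, b, c) (A', b', c') \<and>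
          P_not_strongly_infeasible_cert A' b' l)) \<and>
     (\<not> P_strongly_infeasible A b \<longrightarrow>
       (\<exists>A' b' c' l. reformulation (A, b, c) (A', b', c') \<and>
          P_not_strongly_infeasible_cert A' b' l \<and>
          l \<le> CARD('n) - 1 \<and> pre_strict_FR psd_cone (first_cols A' l @ [b'])))"
proof -
  have cc: "linear A' \<and> coordinate_change (A, b, c) (A', b', c')"
    if "reformulation (A, b, c) (A', b', c')" for A' b' c'
    using reformulation_coordinate_change[OF assms(1) that] coordinate_change_linear[OF assms(1)]
    by blast
  have D: "\<not> D_feasible A c"
    if "reformulation (A, b, c) (A', b', c')" "D_infeasible_cert A' c' k" for A' b' c' k
    using cc[OF that(1)] D_infeasible_cert_sound that(2) D_feasible_coordinate_change[OF assms(1)]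
    by blast
  have DS: "\<not> D_strongly_infeasible A c"
    if "reformulation (A, b, c) (A', b', c')" "D_not_strongly_infeasible_cert A' c' l ys"
    for A' b' c' l ys
    using cc[OF that(1)] D_not_strongly_infeasible_cert_sound that(2)
      D_strongly_infeasible_coordinate_change by blast
  have P: "\<not> P_feasible A b"
    if "reformulation (A, b, c) (A', b', c')" "P_infeasible_cert A' b' k ys" for A' b' c' k ys
    using cc[OF that(1)] P_infeasible_cert_sound that(2) P_feasible_coordinate_change[OF assms(1)]
    by blast
  have PS: "\<not> P_strongly_infeasible A b"
    if "reformulation (A, b, c) (A', b', c')" "P_not_strongly_infeasible_cert A' b' l"
    for A' b' c' l
    using cc[OF that(1)] P_not_strongly_infeasible_cert_sound that(2)
      P_strongly_infeasible_coordinate_change[OF assms(1)] by blast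
  note exist = D_certificate_exists[OF assms(1-3), of c b]
    D_not_strong_certificate_exists[OF assms(1-3), of c b]
    P_certificate_exists[OF assms(1,3,4), of c]
    P_not_strong_certificate_exists[OF assms, of c]
  show ?thesis
    by (intro conjI iffI impI; (erule exist)?) (use exist D DS P PS in blast)+
qed

end
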